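(* Let $G$ be a unimodular locally compact group with Haar measure $dg$, let $\phi_1,\phi_2\colon G\to[0,1]$ be integrable functions, and let $0\le t\le\min\{\|\phi_1\|,\|\phi_2\|\}$ be such that $\|\phi_1\|+\|\phi_2\|\le m(G)+t$. Then $$\|f_t\circ(\phi_1*\phi_2)\|\le(\|\phi_1\|-t)(\|\phi_2\|-t).$$
   Context: $\|\cdot\|$ is the $L^1$-norm with respect to the fixed Haar measure $dg$ on $G$, and $\mathrm{vol}$ is the corresponding Haar volume. $m(G):=\inf_{G'}\mathrm{vol}(G')\in[0,\infty]$, where $G'$ ranges over all open subgroups of $G$. The convolution is $\phi_1*\phi_2(g):=\int_G\phi_1(g')\phi_2(g'^{-1}g)\,dg'$. For $t\ge0$, $f_t(y):=y-t$ if $y\ge t$ and $f_t(y):=0$ if $y\le t$. *)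

theory Defs
  imports "HOL-Analysis.Analysis"
begin

text \<open>
  Groups are rendered by the library class of (Hausdorff) topological groups, which is written
  additively but is not assumed to be commutative: \<open>g + h\<close>, \<open>0\<close>, \<open>- g\<close> stand for the product,
  the neutral element and the inverse.
\<close>

text \<open>
  A measure is defined on the Borel sets of the group.  On groups that are not second countable,
  translation invariance and local finiteness do not determine the measure, so the two regularity
  conditions of a Radon measure are part of the definition.
\<close>

definition radon_measure :: "'a::t2_space measure \<Rightarrow> bool" where
  "radon_measure M \<longleftrightarrow>
     sets M = sets borel \<and>
     (\<forall>K. compact K \<longrightarrow> emeasure M K < \<infinity>) \<and>
     (\<forall>A\<in>sets borel. emeasure M A = (INF U\<in>{U. open U \<and> A \<subseteq> U}. emeasure M U)) \<and>
     (\<forall>U. open U \<longrightarrow> emeasure M U = (SUP K\<in>{K. compact K \<and> K \<subseteq> U}. emeasure M K))"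

definition left_haar_measure :: "'a::{topological_group_add, t2_space} measure \<Rightarrow> bool" where
  "left_haar_measure M \<longleftrightarrow>
     radon_measure M \<and> emeasure M UNIV \<noteq> 0 \<and>
     (\<forall>g. \<forall>A\<in>sets borel. emeasure M ((\<lambda>x. g + x) ` A) = emeasure M A)"

definition unimodular_group :: "'a::{topological_group_add, t2_space} itself \<Rightarrow> bool" where
  "unimodular_group _ \<longleftrightarrow>
     (\<forall>M :: 'a measure. left_haar_measure M \<longrightarrow>
        (\<forall>g. \<forall>A\<in>sets borel. emeasure M ((\<lambda>x. x + g) ` A) = emeasure M A))"

definition is_subgroup :: "'a::group_add set \<Rightarrow> bool" where
  "is_subgroup H \<longleftrightarrow> 0 \<in> H \<and> (\<forall>x\<in>H. \<forall>y\<in>H. x + y \<in> H) \<and> (\<forall>x\<in>H. - x \<in> H)"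

definition min_open_subgroup_vol :: "'a::{topological_group_add, t2_space} measure \<Rightarrow> ennreal" where
  "min_open_subgroup_vol M = (INF H\<in>{H. open H \<and> is_subgroup H}. emeasure M H)"

text \<open>
  Like any Bochner integral, this is \<open>0\<close> if \<open>f\<close> is not integrable; it is the L1-norm only when
  \<open>integrable M f\<close> holds.
\<close>

definition L1_norm :: "'a measure \<Rightarrow> ('a \<Rightarrow> real) \<Rightarrow> real" where
  "L1_norm M f = (\<integral>x. \<bar>f x\<bar> \<partial>M)"

definition convolution :: "'a::group_add measure \<Rightarrow> ('a \<Rightarrow> real) \<Rightarrow> ('a \<Rightarrow> real) \<Rightarrow> 'a \<Rightarrow> real" where
  "convolution M \<phi>1 \<phi>2 g = (\<integral>h. \<phi>1 h * \<phi>2 (- h + g) \<partial>M)"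

definition cutoff :: "real \<Rightarrow> real \<Rightarrow> real" where
  "cutoff t y = (if y \<ge> t then y - t else 0)"

end

theory Submission
  imports Defs
begin

text \<open>
  Write \<open>a\<close>, \<open>b\<close> for the masses of \<open>\<phi>1\<close>, \<open>\<phi>2\<close> and put \<open>\<mu> = a + b - t\<close>, so that \<open>a, b \<le> \<mu>\<close> and every
  open subgroup has volume at least \<open>\<mu>\<close>.  Testing \<open>\<phi>1 * \<phi>2 - t\<close> against \<open>\<chi> : G \<rightarrow> [0,1]\<close> of mass
  \<open>c\<close>, which approximates the indicator function of \<open>{\<phi>1 * \<phi>2 > t}\<close>, reduces the theorem to
  \<open>\<integral> \<chi> (\<phi>1 * \<phi>2) \<le> (\<mu> - a) (\<mu> - b) + (a + b - \<mu>) c\<close>; this is trivial for \<open>c \<ge> \<mu>\<close>.  For \<open>c \<le> \<mu>\<close> it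
  says that \<open>\<integral>\<integral> \<phi>1(h) \<chi>(x) (1 - \<phi>2(h\<inverse> x)) \<ge> (a + c - \<mu>) (\<mu> - b)\<close>.  Replacing \<open>\<phi>1\<close> and \<open>\<chi>\<close> by the
  maximum of one and the minimum of the other with their translates by the same \<open>g\<close> (or by suitable
  more spread-out functions with the same sum, which leaves room in the choice of \<open>\<alpha>\<close> and \<open>\<gamma>\<close>)
  does not increase the left-hand side on average (rearrangement) and moves \<open>(a, c)\<close> to \<open>(a + \<alpha>, c - \<gamma>)\<close> and
  \<open>(a - \<alpha>, c + \<gamma>)\<close>, whereas the right-hand side is affine in \<open>a + c\<close>.  Because no open subgroup has
  volume below \<open>\<mu>\<close>, some \<open>g\<close> makes \<open>\<alpha>\<close> and \<open>\<gamma>\<close> small without both being negligible.  Hence a violation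
  of the inequality would propagate to the boundary of \<open>[0, \<mu>]\<^sup>2\<close>, where the inequality is elementary.
\<close>


section \<open>Continuous functions with compact support\<close>

definition compactly_supported :: "('a::topological_space \<Rightarrow> real) \<Rightarrow> bool" where
  "compactly_supported f \<longleftrightarrow>
     continuous_on UNIV f \<and> (\<exists>K. compact K \<and> (\<forall>x. x \<notin> K \<longrightarrow> f x = 0))"

lemma compactly_supportedI:
  "continuous_on UNIV f \<Longrightarrow> compact K \<Longrightarrow> (\<And>x. x \<notin> K \<Longrightarrow> f x = 0) \<Longrightarrow> compactly_supported f"
  unfolding compactly_supported_def by blast

lemma compactly_supportedE:
  assumes "compactly_supported f"
  obtains K where "compact K" "\<And>x. x \<notin> K \<Longrightarrow> f x = 0"
  using assms unfolding compactly_supported_def by blast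

lemma compactly_supported_continuous: "compactly_supported f \<Longrightarrow> continuous_on UNIV f"
  unfolding compactly_supported_def by blast

lemma compactly_supported_mult_left:
  assumes "compactly_supported f" "continuous_on UNIV g"
  shows "compactly_supported (\<lambda>x. g x * f x)"
  using assms unfolding compactly_supported_def by (auto intro!: continuous_intros)

lemma compactly_supported_mult_right:
  assumes "compactly_supported f" "continuous_on UNIV g"
  shows "compactly_supported (\<lambda>x. f x * g x)"
  using compactly_supported_mult_left[OF assms] by (simp add: mult.commute)

lemma compactly_supported_cmult: "compactly_supported f \<Longrightarrow> compactly_supported (\<lambda>x. c * f x)"
  by (rule compactly_supported_mult_left) auto

lemma compactly_supported_compose2:
  assumes f: "compactly_supported f" and g: "compactly_supported g"
    and F: "continuous_on UNIV (\<lambda>(u, v). F u v)" and 0: "F 0 0 = 0"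
  shows "compactly_supported (\<lambda>x. F (f x) (g x))"
proof -
  obtain K where K: "compact K" "\<And>x. x \<notin> K \<Longrightarrow> f x = 0"
    using f by (rule compactly_supportedE) blast
  obtain L where L: "compact L" "\<And>x. x \<notin> L \<Longrightarrow> g x = 0"
    using g by (rule compactly_supportedE) blast
  show ?thesis
  proof (rule compactly_supportedI)
    have "continuous_on UNIV (\<lambda>x. (\<lambda>(u, v). F u v) (f x, g x))"
      by (rule continuous_on_compose2[OF F])
        (auto intro!: continuous_intros compactly_supported_continuous f g)
    then show "continuous_on UNIV (\<lambda>x. F (f x) (g x))" by simp
    show "compact (K \<union> L)" using K L by auto
  qed (use K L 0 in auto)
qed

lemma compactly_supported_compose:
  assumes "compactly_supported f" "continuous_on UNIV F" "F 0 = 0"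
  shows "compactly_supported (\<lambda>x. F (f x))"
proof -
  have "continuous_on UNIV (\<lambda>(u::real, v::real). F u)"
    unfolding split_beta
    by (rule continuous_on_compose2[OF assms(2)]) (auto intro!: continuous_intros)
  from compactly_supported_compose2[OF assms(1,1) this] assms(3) show ?thesis by simp
qed

lemma compactly_supported_add:
  "compactly_supported f \<Longrightarrow> compactly_supported g \<Longrightarrow> compactly_supported (\<lambda>x. f x + g x)"
  by (rule compactly_supported_compose2[where F = "(+)"])
    (auto simp: split_beta intro!: continuous_intros)

lemma compactly_supported_diff:
  "compactly_supported f \<Longrightarrow> compactly_supported g \<Longrightarrow> compactly_supported (\<lambda>x. f x - g x)"
  by (rule compactly_supported_compose2[where F = "(-)"])
    (auto simp: split_beta intro!: continuous_intros)

lemma compactly_supported_min: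
  "compactly_supported f \<Longrightarrow> compactly_supported g \<Longrightarrow> compactly_supported (\<lambda>x. min (f x) (g x))"
  by (rule compactly_supported_compose2[where F = min])
    (auto simp: split_beta intro!: continuous_intros)

lemma compactly_supported_abs: "compactly_supported f \<Longrightarrow> compactly_supported (\<lambda>x. \<bar>f x\<bar>)"
  by (rule compactly_supported_compose) (auto intro!: continuous_intros)

lemma compactly_supported_section:
  assumes F: "compactly_supported F"
  shows "compactly_supported (\<lambda>y. F (x, y))" "compactly_supported (\<lambda>y. F (y, x'))"
proof -
  obtain K where K: "compact K" "\<And>z. z \<notin> K \<Longrightarrow> F z = 0"
    using F by (rule compactly_supportedE) blast
  note c = continuous_on_compose2[OF compactly_supported_continuous[OF F]]
  show "compactly_supported (\<lambda>y. F (x, y))"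
  proof (rule compactly_supportedI)
    show "compact (snd ` K)" using K by (auto intro!: compact_continuous_image continuous_intros)
  qed (use K in \<open>force intro!: c continuous_intros\<close>)+
  show "compactly_supported (\<lambda>y. F (y, x'))"
  proof (rule compactly_supportedI)
    show "compact (fst ` K)" using K by (auto intro!: compact_continuous_image continuous_intros)
  qed (use K in \<open>force intro!: c continuous_intros\<close>)+
qed

lemma compactly_supported_swap:
  assumes F: "compactly_supported F"
  shows "compactly_supported (\<lambda>(y, x). F (x, y))"
proof -
  obtain K where K: "compact K" "\<And>z. z \<notin> K \<Longrightarrow> F z = 0"
    using F by (rule compactly_supportedE) blast
  note c = continuous_on_compose2[OF compactly_supported_continuous[OF F]]
  have "compact (prod.swap ` K)"
    using K by (auto intro!: compact_continuous_image continuous_on_swap)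
  then show ?thesis
    by (rule compactly_supportedI[rotated])
      (use K in \<open>force intro!: c continuous_intros simp: split_beta\<close>)+
qed

lemma compactly_supported_rectangle:
  assumes "compactly_supported F"
  obtains A B where "compact A" "compact B" "\<And>x y. x \<notin> A \<or> y \<notin> B \<Longrightarrow> F (x, y) = 0"
proof -
  obtain K where K: "compact K" "\<And>z. z \<notin> K \<Longrightarrow> F z = 0"
    using assms by (rule compactly_supportedE) blast
  show ?thesis
  proof (rule that[of "fst ` K" "snd ` K"])
    show "compact (fst ` K)" "compact (snd ` K)"
      using K by (auto intro!: compact_continuous_image continuous_intros)
    show "F (x, y) = 0" if "x \<notin> fst ` K \<or> y \<notin> snd ` K" for x y
      using that by (intro K(2)) force
  qed
qed

section \<open>Integration of compactly supported functions against a Radon measure\<close>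

lemma radon_measure_sets: "radon_measure M \<Longrightarrow> sets M = sets borel"
  by (simp add: radon_measure_def)

lemma radon_measure_space: "radon_measure M \<Longrightarrow> space M = UNIV"
  using sets_eq_imp_space_eq[OF radon_measure_sets] by simp

lemma radon_measure_compact: "radon_measure M \<Longrightarrow> compact K \<Longrightarrow> emeasure M K < \<infinity>"
  by (simp add: radon_measure_def)

lemma radon_measurable: "radon_measure M \<Longrightarrow> f \<in> borel_measurable borel \<Longrightarrow> f \<in> borel_measurable M"
  using measurable_cong_sets[OF radon_measure_sets refl] by blast

lemma radon_measure_compact_sets: "radon_measure M \<Longrightarrow> compact K \<Longrightarrow> K \<in> sets M"
  by (auto simp: radon_measure_sets intro!: borel_closed compact_imp_closed)

lemma integrable_indicator_compact:
  "radon_measure M \<Longrightarrow> compact K \<Longrightarrow> integrable M (indicator K :: _ \<Rightarrow> real)"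
  by (intro integrable_real_indicator radon_measure_compact_sets radon_measure_compact)

lemma compactly_supported_bounded:
  assumes "compactly_supported f" shows "\<exists>B\<ge>0. \<forall>x. \<bar>f x\<bar> \<le> B"
proof -
  obtain K where K: "compact K" "\<And>x. x \<notin> K \<Longrightarrow> f x = 0"
    using assms by (rule compactly_supportedE) blast
  have "compact (f ` K)"
    using K(1) compactly_supported_continuous[OF assms] continuous_on_subset
    by (blast intro: compact_continuous_image)
  then obtain B where B: "\<And>x. x \<in> K \<Longrightarrow> \<bar>f x\<bar> \<le> B"
    by (force dest: compact_imp_bounded simp: bounded_iff)
  have "\<bar>f x\<bar> \<le> max 0 B" for x
    using B[of x] K(2)[of x] by (cases "x \<in> K") auto
  then show ?thesis
    by (intro exI[of _ "max 0 B"]) auto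
qed

lemma integrable_compactly_supported:
  assumes M: "radon_measure M" and f: "compactly_supported f"
  shows "integrable M f"
proof -
  obtain K where K: "compact K" "\<And>x. x \<notin> K \<Longrightarrow> f x = 0"
    using f by (rule compactly_supportedE) blast
  obtain B where B: "\<And>x. \<bar>f x\<bar> \<le> B"
    using compactly_supported_bounded[OF f] by blast
  have "integrable M (\<lambda>x. B * indicator K x)"
    using integrable_indicator_compact[OF M K(1)] by simp
  then show ?thesis
  proof (rule Bochner_Integration.integrable_bound)
    show "f \<in> borel_measurable M"
      by (intro radon_measurable[OF M] borel_measurable_continuous_onI compactly_supported_continuous f)
    show "AE x in M. norm (f x) \<le> norm (B * indicator K x)"
    proof (rule AE_I2)
      fix x show "norm (f x) \<le> norm (B * indicator K x)"
        using B[of x] K(2)[of x] by (cases "x \<in> K") auto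
    qed
  qed
qed

text \<open>Turns uniform closeness on a compact set into closeness of integrals, since compact sets
  have finite measure.\<close>

lemma integral_diff_le_on_compact:
  fixes f g :: "'a::t2_space \<Rightarrow> real"
  assumes M: "radon_measure M" and B: "compact B" and f: "integrable M f" and g: "integrable M g"
    and le: "\<And>x. x \<in> B \<Longrightarrow> \<bar>f x - g x\<bar> \<le> e" and z: "\<And>x. x \<notin> B \<Longrightarrow> f x = 0 \<and> g x = 0"
  shows "\<bar>(\<integral>x. f x \<partial>M) - (\<integral>x. g x \<partial>M)\<bar> \<le> e * measure M B"
proof -
  have "\<bar>(\<integral>x. f x \<partial>M) - (\<integral>x. g x \<partial>M)\<bar> = \<bar>\<integral>x. f x - g x \<partial>M\<bar>"
    using f g by simp
  also have "\<dots> \<le> (\<integral>x. \<bar>f x - g x\<bar> \<partial>M)"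
    by (rule integral_abs_bound)
  also have "\<dots> \<le> (\<integral>x. e * indicator B x \<partial>M)"
  proof (rule integral_mono)
    show "integrable M (\<lambda>x. e * indicator B x)"
      using integrable_indicator_compact[OF M B] by simp
    show "\<bar>f x - g x\<bar> \<le> e * indicator B x" for x
      using le[of x] z[of x] by (cases "x \<in> B") auto
  qed (use f g in auto)
  also have "\<dots> = e * measure M B"
    using radon_measure_compact_sets[OF M B] radon_measure_space[OF M] by simp
  finally show ?thesis .
qed

text \<open>For \<open>y\<close> in the compact set \<open>B\<close>, \<open>F (x, y)\<close> is
  continuous in \<open>x\<close> uniformly in \<open>y\<close>, so the finite measure of
  \<open>B\<close> controls the change of the integral.\<close>

lemma compactly_supported_integral:
  fixes F :: "'a::t2_space \<times> 'b::t2_space \<Rightarrow> real"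
  assumes N: "radon_measure N" and F: "compactly_supported F"
  shows "compactly_supported (\<lambda>x. \<integral>y. F (x, y) \<partial>N)"
proof -
  obtain A B where A: "compact A" and B: "compact B"
    and z: "\<And>x y. x \<notin> A \<or> y \<notin> B \<Longrightarrow> F (x, y) = 0"
    using F by (rule compactly_supported_rectangle) blast
  have int: "integrable N (\<lambda>y. F (x, y))" for x
    by (rule integrable_compactly_supported[OF N compactly_supported_section(1)[OF F]])
  show ?thesis
  proof (rule compactly_supportedI[OF _ A])
    show "continuous_on UNIV (\<lambda>x. \<integral>y. F (x, y) \<partial>N)"
      unfolding continuous_on_def
    proof (intro ballI tendstoI)
      fix x0 :: 'a and e :: real assume e: "e > 0"
      \<comment> \<open>The summand 1 keeps the denominator positive when \<open>B\<close> has
        measure zero.\<close>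
      define d where "d = e / (measure N B + 1)"
      have d: "d > 0" "d * measure N B < e"
        using e measure_nonneg[of N B] by (auto simp: d_def field_simps add_pos_nonneg)
      obtain X0 where X0: "x0 \<in> X0" "open X0"
        "\<forall>x\<in>X0 \<inter> UNIV. \<forall>t\<in>B. dist (F (x, t)) (F (x0, t)) \<le> d"
        by (rule continuous_on_prod_compactE[of UNIV B F x0 d])
          (use F B d in \<open>auto intro: continuous_on_subset[OF compactly_supported_continuous]\<close>)
      have "dist (\<integral>y. F (x, y) \<partial>N) (\<integral>y. F (x0, y) \<partial>N) < e" if "x \<in> X0" for x
      proof -
        have "\<bar>(\<integral>y. F (x, y) \<partial>N) - (\<integral>y. F (x0, y) \<partial>N)\<bar> \<le> d * measure N B"
          by (rule integral_diff_le_on_compact[OF N B int int])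
            (use X0 that z in \<open>auto simp: dist_real_def\<close>)
        then show ?thesis using d by (simp add: dist_real_def)
      qed
      then show "\<forall>\<^sub>F x in at x0 within UNIV. dist (\<integral>y. F (x, y) \<partial>N) (\<integral>y. F (x0, y) \<partial>N) < e"
        using X0 by (auto simp: eventually_at_topological)
    qed
  qed (use z in auto)
qed

text \<open>
  The product of the Borel sigma-algebras can be smaller than the Borel sigma-algebra of the
  product, so Tonelli's theorem of the library does not apply.  Instead, a continuous function on
  a compact rectangle is approximated uniformly by functions that depend on \<open>x\<close> only through the
  member of a finite partition.
\<close>

lemma integral_swap_compactly_supported:
  fixes F :: "'a::t2_space \<times> 'b::t2_space \<Rightarrow> real"
  assumes M: "radon_measure M" and N: "radon_measure N" and F: "compactly_supported F"
  shows "(\<integral>x. \<integral>y. F (x, y) \<partial>N \<partial>M) = (\<integral>y. \<integral>x. F (x, y) \<partial>M \<partial>N)" (is "?L = ?R")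
proof -
  obtain A B where A: "compact A" and B: "compact B"
    and z: "\<And>x y. x \<notin> A \<or> y \<notin> B \<Longrightarrow> F (x, y) = 0"
    using F by (rule compactly_supported_rectangle) blast
  have intN: "integrable N (\<lambda>y. F (x, y))" for x
    by (rule integrable_compactly_supported[OF N compactly_supported_section(1)[OF F]])
  have intM: "integrable M (\<lambda>x. F (x, y))" for y
    by (rule integrable_compactly_supported[OF M compactly_supported_section(2)[OF F]])
  have F': "compactly_supported (\<lambda>(y, x). F (x, y))"
    by (rule compactly_supported_swap[OF F])
  have intL: "integrable M (\<lambda>x. \<integral>y. F (x, y) \<partial>N)"
    by (rule integrable_compactly_supported[OF M compactly_supported_integral[OF N F]])
  have intR: "integrable N (\<lambda>y. \<integral>x. F (x, y) \<partial>M)"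
    using integrable_compactly_supported[OF N compactly_supported_integral[OF M F']] by simp
  have bound: "\<bar>?L - ?R\<bar> \<le> e * (2 * measure M A * measure N B)" if e: "e > 0" for e
  proof -
    have "\<forall>x. \<exists>X. x \<in> X \<and> open X \<and> (\<forall>x'\<in>X. \<forall>t\<in>B. dist (F (x', t)) (F (x, t)) \<le> e)"
    proof
      fix x0
      obtain X0 where X0: "x0 \<in> X0" "open X0"
        "\<forall>x\<in>X0 \<inter> UNIV. \<forall>t\<in>B. dist (F (x, t)) (F (x0, t)) \<le> e"
        by (rule continuous_on_prod_compactE[of UNIV B F x0 e])
          (use F B e in \<open>auto intro: continuous_on_subset[OF compactly_supported_continuous]\<close>)
      then show "\<exists>X. x0 \<in> X \<and> open X \<and> (\<forall>x'\<in>X. \<forall>t\<in>B. dist (F (x', t)) (F (x0, t)) \<le> e)"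
        by auto
    qed
    then obtain X where X: "\<And>x. x \<in> X x" "\<And>x. open (X x)"
      "\<And>x x' t. x' \<in> X x \<Longrightarrow> t \<in> B \<Longrightarrow> dist (F (x', t)) (F (x, t)) \<le> e"
      by metis
    have "A \<subseteq> (\<Union>x\<in>A. X x)" using X(1) by auto
    then obtain D where D: "finite D" "A \<subseteq> (\<Union>x\<in>D. X x)"
      by (rule compactE_image[OF A, of A X, OF X(2)])
    obtain c :: "nat \<Rightarrow> 'a" and n where c: "D = c ` {i. i < n}"
      using finite_imp_nat_seg_image_inj_on[OF D(1)] by blast
    \<comment> \<open>The finite cover is numbered in order to be made disjoint: the
      \<open>E i\<close> are disjoint Borel sets, and those with \<open>i < n\<close> partition
      \<open>A\<close>.\<close>
    define E where "E i = A \<inter> disjointed (\<lambda>i. X (c i)) i" for i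
    have E_sets: "E i \<in> sets M" for i
      unfolding E_def disjointed_def radon_measure_sets[OF M]
      using X(2) by (intro sets.Int borel_closed[OF compact_imp_closed[OF A]] sets.Diff sets.finite_UN) auto
    have intE: "integrable M (indicator (E i) :: _ \<Rightarrow> real)" for i
    proof (rule integrable_real_indicator[OF E_sets])
      have "emeasure M (E i) \<le> emeasure M A"
        by (rule emeasure_mono) (auto simp: E_def radon_measure_compact_sets[OF M A])
      then show "emeasure M (E i) < \<infinity>"
        using radon_measure_compact[OF M A] by (rule le_less_trans)
    qed
    \<comment> \<open>On \<open>E i\<close> the first argument is frozen at \<open>c i\<close>. As a
      finite sum of products, \<open>S\<close> has equal iterated integrals by linearity
      alone.\<close>
    define S where "S x y = (\<Sum>i<n. indicator (E i) x * F (c i, y))" for x y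
    have S_close: "\<bar>F (x, y) - S x y\<bar> \<le> e" if x: "x \<in> A" and y: "y \<in> B" for x y
    proof -
      have "\<exists>i<n. x \<in> X (c i)"
        using D(2) x c by auto
      define k where "k = (LEAST i. x \<in> X (c i))"
      have k: "x \<in> X (c k)" "k < n"
        unfolding k_def using \<open>\<exists>i<n. x \<in> X (c i)\<close>
        by (auto intro: LeastI Least_le[THEN le_less_trans])
      have "x \<notin> X (c j)" if "j < k" for j
        using that not_less_Least unfolding k_def by blast
      then have "x \<in> E i \<longleftrightarrow> i = k" for i
        unfolding E_def disjointed_def using k x by auto (metis atLeastLessThan_iff linorder_neqE_nat zero_le)
      then have "S x y = (\<Sum>i<n. if i = k then F (c k, y) else 0)"
        unfolding S_def by (intro sum.cong) (auto simp: indicator_def)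
      then have "S x y = F (c k, y)"
        using k by simp
      then show ?thesis
        using X(3)[OF k(1) y] by (simp add: dist_real_def)
    qed
    have S_zero: "S x y = 0" if "x \<notin> A \<or> y \<notin> B" for x y
      unfolding S_def using that z by (intro sum.neutral) (auto simp: E_def indicator_def)
    have intS1: "integrable N (\<lambda>y. S x y)" for x
      unfolding S_def by (intro Bochner_Integration.integrable_sum integrable_mult_right intN)
    have intS2: "integrable M (\<lambda>x. S x y)" for y
      unfolding S_def by (intro Bochner_Integration.integrable_sum integrable_mult_left intE)
    have S1: "(\<integral>y. S x y \<partial>N) = (\<Sum>i<n. indicator (E i) x * (\<integral>y. F (c i, y) \<partial>N))" for x
      unfolding S_def using intN by (simp add: Bochner_Integration.integral_sum)
    have S2: "(\<integral>x. S x y \<partial>M) = (\<Sum>i<n. measure M (E i) * F (c i, y))" for y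
      unfolding S_def using intE
      by (simp add: Bochner_Integration.integral_sum radon_measure_space[OF M] del: sum_mult_indicator sum_indicator_mult)
    have intS1': "integrable M (\<lambda>x. \<integral>y. S x y \<partial>N)"
      unfolding S1 by (intro Bochner_Integration.integrable_sum integrable_mult_left intE)
    have intS2': "integrable N (\<lambda>y. \<integral>x. S x y \<partial>M)"
      unfolding S2 by (intro Bochner_Integration.integrable_sum integrable_mult_right intN)
    have eq: "(\<integral>x. \<integral>y. S x y \<partial>N \<partial>M) = (\<integral>y. \<integral>x. S x y \<partial>M \<partial>N)"
      unfolding S1 S2 using intE intN
      by (simp add: Bochner_Integration.integral_sum radon_measure_space[OF M] del: sum_mult_indicator sum_indicator_mult)
    \<comment> \<open>Each iterated integral of \<open>F\<close> differs from that of
      \<open>S\<close> by at most \<open>e\<close> times the product of the measures of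
      \<open>A\<close> and \<open>B\<close>.\<close>
    have "\<bar>?L - (\<integral>x. \<integral>y. S x y \<partial>N \<partial>M)\<bar> \<le> (e * measure N B) * measure M A"
    proof (rule integral_diff_le_on_compact[OF M A intL intS1'])
      show "\<bar>(\<integral>y. F (x, y) \<partial>N) - (\<integral>y. S x y \<partial>N)\<bar> \<le> e * measure N B" if "x \<in> A" for x
        by (rule integral_diff_le_on_compact[OF N B intN intS1]) (use S_close S_zero z that in auto)
    qed (use S_zero z in auto)
    moreover have "\<bar>?R - (\<integral>y. \<integral>x. S x y \<partial>M \<partial>N)\<bar> \<le> (e * measure M A) * measure N B"
    proof (rule integral_diff_le_on_compact[OF N B intR intS2'])
      show "\<bar>(\<integral>x. F (x, y) \<partial>M) - (\<integral>x. S x y \<partial>M)\<bar> \<le> e * measure M A" if "y \<in> B" for y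
        by (rule integral_diff_le_on_compact[OF M A intM intS2]) (use S_close S_zero z that in auto)
    qed (use S_zero z in auto)
    ultimately show ?thesis
      using eq by (simp add: algebra_simps)
  qed
  have "\<bar>?L - ?R\<bar> \<le> 0"
  proof (rule field_le_epsilon)
    fix e :: real assume e: "e > 0"
    define C where "C = 2 * measure M A * measure N B"
    have C: "C \<ge> 0" by (simp add: C_def)
    have "0 < e / (C + 1)" using e C by simp
    from bound[OF this] have "\<bar>?L - ?R\<bar> \<le> e / (C + 1) * C"
      unfolding C_def .
    also have "\<dots> \<le> e"
      using e C by (simp add: field_simps)
    finally show "\<bar>?L - ?R\<bar> \<le> 0 + e" by simp
  qed
  then show ?thesis by simp
qed

text \<open>Locally compact Hausdorff spaces are completely regular, which separates single points
  from closed sets; compactness of \<open>K\<close> combines finitely many of these functions into a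
  truncated sum. Staying inside a neighbourhood \<open>V\<close> contained in the compact set
  \<open>L\<close> makes the support compact.\<close>

lemma urysohn_compactly_supported:
  fixes K U :: "'a::t2_space set"
  assumes loc: "locally_compact_space (euclidean :: 'a topology)"
    and K: "compact K" and U: "open U" and KU: "K \<subseteq> U"
  obtains w where "compactly_supported w" "\<And>x. 0 \<le> w x" "\<And>x. w x \<le> 1"
    "\<And>x. x \<in> K \<Longrightarrow> w x = 1" "\<And>x. x \<notin> U \<Longrightarrow> w x = 0"
proof -
  have haus: "Hausdorff_space (euclidean :: 'a topology)"
    by (simp add: Hausdorff_space_def) (metis disjnt_def hausdorff)
  obtain V L where V: "open V" and L: "compact L" and KVL: "K \<subseteq> V" "V \<subseteq> L"
    using loc K unfolding locally_compact_space_compact_closed_compact[OF disjI1[OF haus]]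
    by (auto simp: compactin_euclidean_iff)
  have "completely_regular_space (euclidean :: 'a topology)"
    using locally_compact_regular_imp_completely_regular_space[OF loc disjI1[OF haus]] .
  \<comment> \<open>The value 2 leaves room for the open sets where \<open>f x\<close> exceeds 1, so
    that truncation at 1 gives exactly 1 on \<open>K\<close>.\<close>
  then have "\<exists>f. continuous_on UNIV f \<and> f x = (2::real) \<and> (\<forall>y. y \<notin> U \<inter> V \<longrightarrow> f y = 0)"
    if "x \<in> K" for x
    unfolding completely_regular_space_gen_alt'[of 2 0, simplified]
    using U V KU KVL that
    by (auto dest!: spec[of _ "U \<inter> V"] spec[of _ x]) (auto simp: image_subset_iff)
  then obtain f where f: "\<And>x. x \<in> K \<Longrightarrow> continuous_on UNIV (f x)" "\<And>x. x \<in> K \<Longrightarrow> f x x = (2::real)"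
    "\<And>x y. x \<in> K \<Longrightarrow> y \<notin> U \<inter> V \<Longrightarrow> f x y = 0"
    by metis
  have op: "open {y. 1 < f x y}" if "x \<in> K" for x
    using f(1)[OF that] by (intro open_Collect_less) auto
  obtain D where D: "D \<subseteq> K" "finite D" "K \<subseteq> (\<Union>x\<in>D. {y. 1 < f x y})"
    using compactE_image[OF K, of K "\<lambda>x. {y. 1 < f x y}"] op f(2) by force
  define w where "w y = min 1 (\<Sum>x\<in>D. \<bar>f x y\<bar>)" for y
  have zero: "w y = 0" if "y \<notin> U \<inter> V" for y
    using f(3) D(1) that by (auto simp: w_def subset_iff intro!: sum.neutral)
  show ?thesis
  proof (rule that[of w])
    show "compactly_supported w"
    proof (rule compactly_supportedI[OF _ L])
      show "continuous_on UNIV w"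
        unfolding w_def using D f(1) by (auto intro!: continuous_intros)
    qed (use zero KVL in auto)
    show "w x = 1" if x: "x \<in> K" for x
    proof -
      obtain d where d: "d \<in> D" "1 < f d x" using D x by auto
      have "\<bar>f d x\<bar> \<le> (\<Sum>x'\<in>D. \<bar>f x' x\<bar>)"
        by (rule member_le_sum) (use d D in auto)
      then show ?thesis using d by (simp add: w_def)
    qed
    show "w x = 0" if "x \<notin> U" for x
      using zero that by auto
  qed (auto simp: w_def sum_nonneg)
qed

section \<open>The subgroup generated by a neighbourhood of the identity\<close>

text \<open>Inverses of letters are not adjoined, so this is a subgroup only under a symmetry
  condition on \<open>V\<close>. Letters are added on the left, to match the induction over small
  translations \<open>v + g\<close>.\<close>

inductive_set generated_subgroup :: "'a::group_add set \<Rightarrow> 'a set" for V where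
  zero: "0 \<in> generated_subgroup V"
| step: "v \<in> V \<Longrightarrow> g \<in> generated_subgroup V \<Longrightarrow> v + g \<in> generated_subgroup V"

lemma generated_subgroup_is_subgroup:
  assumes V: "\<And>v. v \<in> V \<Longrightarrow> - v \<in> V"
  shows "is_subgroup (generated_subgroup V)"
proof -
  have add: "x + y \<in> generated_subgroup V" if "x \<in> generated_subgroup V" "y \<in> generated_subgroup V" for x y
    using that by induction (auto simp: add.assoc intro: generated_subgroup.step)
  have "- x \<in> generated_subgroup V" if "x \<in> generated_subgroup V" for x
    using that
  proof induction
    case (step v g)
    \<comment> \<open>Inversion reverses the order, so the new letter ends up on the right and
      closure under addition is required.\<close>
    have "- v + 0 \<in> generated_subgroup V"
      by (intro generated_subgroup.intros V step)
    from add[OF step.IH this] show ?case by (simp add: minus_add)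
  qed (simp add: generated_subgroup.zero)
  with add show ?thesis by (auto simp: is_subgroup_def generated_subgroup.zero)
qed

text \<open>The set is the union of the translates \<open>V + h\<close> of the open set
  \<open>V\<close>, over its own elements \<open>h\<close>.\<close>

lemma generated_subgroup_open:
  fixes V :: "'a::{topological_group_add, t2_space} set"
  assumes V: "open V" "0 \<in> V"
  shows "open (generated_subgroup V)"
proof -
  have "generated_subgroup V = (\<Union>h\<in>generated_subgroup V. (\<lambda>x. x + - h) -` V)"
  proof (intro set_eqI iffI)
    fix x assume "x \<in> generated_subgroup V"
    then show "x \<in> (\<Union>h\<in>generated_subgroup V. (\<lambda>x. x + - h) -` V)"
      using V by (auto intro!: bexI[of _ x])
  next
    fix x assume "x \<in> (\<Union>h\<in>generated_subgroup V. (\<lambda>x. x + - h) -` V)"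
    then obtain h where "h \<in> generated_subgroup V" "x + - h \<in> V" by auto
    then have "x + - h + h \<in> generated_subgroup V" by (intro generated_subgroup.step)
    then show "x \<in> generated_subgroup V" by (simp add: add.assoc)
  qed
  moreover have "open ((\<lambda>x. x + - h) -` V)" for h
    by (intro open_vimage V continuous_intros)
  ultimately show ?thesis by (metis (no_types, lifting) open_UN)
qed

section \<open>Haar measure on a unimodular group\<close>

locale unimodular_haar =
  fixes M :: "'a::{topological_group_add, t2_space} measure"
  assumes locally_compact: "locally_compact_space (euclidean :: 'a topology)"
    and haar: "left_haar_measure M"
    and right_invariant: "\<And>g A. A \<in> sets borel \<Longrightarrow> emeasure M ((\<lambda>x. x + g) ` A) = emeasure M A"
begin

lemma radon: "radon_measure M"
  using haar by (simp add: left_haar_measure_def)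

lemma left_invariant: "A \<in> sets borel \<Longrightarrow> emeasure M ((\<lambda>x. g + x) ` A) = emeasure M A"
  using haar by (simp add: left_haar_measure_def)

lemmas sets_M [simp] = radon_measure_sets[OF radon]
lemmas space_M [simp] = radon_measure_space[OF radon]

lemma measurable_M: "f \<in> borel_measurable borel \<longleftrightarrow> f \<in> borel_measurable M"
  by (rule iffI; erule measurable_cong_sets[THEN equalityD1, THEN subsetD, rotated -1]; simp)

lemma integrable_cs: "compactly_supported f \<Longrightarrow> integrable M f"
  by (rule integrable_compactly_supported[OF radon])

lemma continuous_measurable_M:
  fixes k :: "'a \<Rightarrow> 'a"
  assumes "continuous_on UNIV k" shows "k \<in> measurable M M"
  using borel_measurable_continuous_onI[OF assms]
  by (simp add: measurable_def)

lemma distr_left: "distr M M (\<lambda>x. g + x) = M"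
proof (rule measure_eqI)
  fix A assume "A \<in> sets (distr M M (\<lambda>x. g + x))"
  then have A: "A \<in> sets borel" by simp
  have m: "(\<lambda>x. g + x) \<in> measurable M M"
    by (intro continuous_measurable_M continuous_intros)
  have "(\<lambda>x. g + x) -` A = (\<lambda>x. - g + x) ` A"
    by (force simp: image_iff add.assoc[symmetric])
  then show "emeasure (distr M M (\<lambda>x. g + x)) A = emeasure M A"
    using A left_invariant[of A "- g"] by (simp add: emeasure_distr[OF m])
qed simp

lemma distr_right: "distr M M (\<lambda>x. x + g) = M"
proof (rule measure_eqI)
  fix A assume "A \<in> sets (distr M M (\<lambda>x. x + g))"
  then have A: "A \<in> sets borel" by simp
  have m: "(\<lambda>x. x + g) \<in> measurable M M"
    by (intro continuous_measurable_M continuous_intros)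
  have "(\<lambda>x. x + g) -` A = (\<lambda>x. x + - g) ` A"
    by (force simp: image_iff add.assoc)
  then show "emeasure (distr M M (\<lambda>x. x + g)) A = emeasure M A"
    using A right_invariant[of A "- g"] by (simp add: emeasure_distr[OF m])
qed simp

lemma integral_left:
  fixes f :: "'a \<Rightarrow> real"
  assumes "f \<in> borel_measurable borel"
  shows "(\<integral>x. f (g + x) \<partial>M) = (\<integral>x. f x \<partial>M)"
proof -
  have "(\<integral>x. f x \<partial>M) = (\<integral>x. f x \<partial>distr M M (\<lambda>x. g + x))"
    by (simp only: distr_left)
  also have "\<dots> = (\<integral>x. f (g + x) \<partial>M)"
    using assms by (intro integral_distr continuous_measurable_M continuous_intros) (simp add: measurable_M)
  finally show ?thesis ..
qed

lemma integral_right: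
  fixes f :: "'a \<Rightarrow> real"
  assumes "f \<in> borel_measurable borel"
  shows "(\<integral>x. f (x + g) \<partial>M) = (\<integral>x. f x \<partial>M)"
proof -
  have "(\<integral>x. f x \<partial>M) = (\<integral>x. f x \<partial>distr M M (\<lambda>x. x + g))"
    by (simp only: distr_right)
  also have "\<dots> = (\<integral>x. f (x + g) \<partial>M)"
    using assms by (intro integral_distr continuous_measurable_M continuous_intros) (simp add: measurable_M)
  finally show ?thesis ..
qed

section \<open>Translates, reflections and kernels of compact support\<close>

lemma measurable_cs: "compactly_supported f \<Longrightarrow> f \<in> borel_measurable borel"
  by (intro borel_measurable_continuous_onI compactly_supported_continuous)

lemma compactly_supported_left:
  assumes f: "compactly_supported f"
  shows "compactly_supported (\<lambda>x::'a. f (g + x))"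
proof -
  obtain K where K: "compact K" "\<And>x. x \<notin> K \<Longrightarrow> f x = 0"
    using f by (rule compactly_supportedE) blast
  show ?thesis
  proof (rule compactly_supportedI)
    show "continuous_on UNIV (\<lambda>x. f (g + x))"
      by (rule continuous_on_compose2[OF compactly_supported_continuous[OF f]])
        (auto intro!: continuous_intros)
    show "compact ((\<lambda>x. - g + x) ` K)"
      using K by (intro compact_continuous_image continuous_intros)
    show "f (g + x) = 0" if "x \<notin> (\<lambda>x. - g + x) ` K" for x
      using that by (intro K(2)) (force simp: image_iff add.assoc[symmetric])
  qed
qed

lemma compactly_supported_uminus:
  assumes f: "compactly_supported f"
  shows "compactly_supported (\<lambda>x::'a. f (- x))"
proof -
  obtain K where K: "compact K" "\<And>x. x \<notin> K \<Longrightarrow> f x = 0"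
    using f by (rule compactly_supportedE) blast
  show ?thesis
  proof (rule compactly_supportedI)
    show "continuous_on UNIV (\<lambda>x. f (- x))"
      by (rule continuous_on_compose2[OF compactly_supported_continuous[OF f]])
        (auto intro!: continuous_intros)
    show "compact (uminus ` K)"
      using K by (intro compact_continuous_image continuous_intros)
    show "f (- x) = 0" if "x \<notin> uminus ` K" for x
      using that by (intro K(2)) (force simp: image_iff)
  qed
qed

text \<open>
  The hypothesis on \<open>m\<close> says that \<open>y\<close> depends continuously on \<open>x\<close> and \<open>k x y\<close>; hence it stays in
  a compact set when these do.
\<close>

lemma compactly_supported_twisted_product:
  fixes k m :: "'a \<Rightarrow> 'a \<Rightarrow> 'a"
  assumes p: "compactly_supported p" and q: "compactly_supported q"
    and k: "continuous_on UNIV (\<lambda>z. k (fst z) (snd z))"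
    and m: "continuous_on UNIV (\<lambda>z. m (fst z) (snd z))" and mk: "\<And>x y. m x (k x y) = y"
  shows "compactly_supported (\<lambda>(x, y). p x * q (k x y))"
proof -
  obtain K where K: "compact K" "\<And>x. x \<notin> K \<Longrightarrow> p x = 0"
    using p by (rule compactly_supportedE) blast
  obtain L where L: "compact L" "\<And>x. x \<notin> L \<Longrightarrow> q x = 0"
    using q by (rule compactly_supportedE) blast
  show ?thesis
  proof (rule compactly_supportedI)
    show "continuous_on UNIV (\<lambda>(x, y). p x * q (k x y))"
      unfolding split_beta
      by (intro continuous_on_mult continuous_on_compose2[OF compactly_supported_continuous[OF p]]
          continuous_on_compose2[OF compactly_supported_continuous[OF q] k] continuous_intros) auto
    show "compact ((\<lambda>z. (fst z, m (fst z) (snd z))) ` (K \<times> L))"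
      by (intro compact_continuous_image compact_Times K L continuous_intros
          continuous_on_subset[OF m]) auto
    show "(case z of (x, y) \<Rightarrow> p x * q (k x y)) = 0"
      if "z \<notin> (\<lambda>z. (fst z, m (fst z) (snd z))) ` (K \<times> L)" for z
    proof -
      obtain x y where z: "z = (x, y)" by fastforce
      have "x \<notin> K \<or> k x y \<notin> L"
      proof (rule ccontr)
        assume "\<not> (x \<notin> K \<or> k x y \<notin> L)"
        then have "(x, k x y) \<in> K \<times> L" by simp
        then have "(\<lambda>z. (fst z, m (fst z) (snd z))) (x, k x y) \<in> (\<lambda>z. (fst z, m (fst z) (snd z))) ` (K \<times> L)"
          by (rule imageI)
        then show False using that by (simp add: z mk)
      qed
      then show ?thesis using K L z by auto
    qed
  qed
qed

lemma compactly_supported_left_product: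
  assumes "compactly_supported p" "compactly_supported q"
  shows "compactly_supported (\<lambda>(x, y). p x * q (x + y :: 'a))"
  by (rule compactly_supported_twisted_product[where m = "\<lambda>x z. - x + z"])
    (use assms in \<open>auto intro!: continuous_intros simp: add.assoc[symmetric]\<close>)

lemma compactly_supported_right_product:
  assumes "compactly_supported p" "compactly_supported q"
  shows "compactly_supported (\<lambda>(x, y). p x * q (y + x :: 'a))"
  by (rule compactly_supported_twisted_product[where m = "\<lambda>x z. z + - x"])
    (use assms in \<open>auto intro!: continuous_intros simp: add.assoc\<close>)

lemma compactly_supported_convolution_kernel:
  assumes "compactly_supported p" "compactly_supported q"
  shows "compactly_supported (\<lambda>(x, y). p x * q (- x + y :: 'a))"
  by (rule compactly_supported_twisted_product[where m = "\<lambda>x z. x + z"])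
    (use assms in \<open>auto intro!: continuous_intros simp: add.assoc[symmetric]\<close>)

lemma compactly_supported_convolution_kernel':
  assumes "compactly_supported p" "compactly_supported q"
  shows "compactly_supported (\<lambda>(x, y). p x * q (- y + x :: 'a))"
  by (rule compactly_supported_twisted_product[where m = "\<lambda>x z. x + - z"])
    (use assms in \<open>auto intro!: continuous_intros simp: add.assoc[symmetric] minus_add\<close>)

lemma compactly_supported_product:
  assumes "compactly_supported p" "compactly_supported q"
  shows "compactly_supported (\<lambda>(x :: 'a, y :: 'a). p x * q y)"
  by (rule compactly_supported_twisted_product[where k = "\<lambda>x y. y" and m = "\<lambda>x z. z"])
    (use assms in \<open>auto intro!: continuous_intros\<close>)

section \<open>Regularity of the Haar measure and its invariance under inversion\<close>

lemma urysohn: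
  fixes K U :: "'a set"
  assumes "compact K" "open U" "K \<subseteq> U"
  obtains w where "compactly_supported w" "\<And>x. 0 \<le> w x" "\<And>x. w x \<le> 1"
    "\<And>x. x \<in> K \<Longrightarrow> w x = 1" "\<And>x. x \<notin> U \<Longrightarrow> w x = (0::real)"
  using urysohn_compactly_supported[OF locally_compact assms] by blast

lemma emeasure_open: "open U \<Longrightarrow> emeasure M U = (SUP K\<in>{K. compact K \<and> K \<subseteq> U}. emeasure M K)"
  by (rule radon[unfolded radon_measure_def, THEN conjunct2, THEN conjunct2, THEN conjunct2, rule_format])

lemma emeasure_outer:
  "A \<in> sets borel \<Longrightarrow> emeasure M A = (INF U\<in>{U. open U \<and> A \<subseteq> U}. emeasure M U)"
  by (rule radon[unfolded radon_measure_def, THEN conjunct2, THEN conjunct2, THEN conjunct1, rule_format])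

lemma measure_compact_le_integral:
  assumes K: "compact K" and w: "compactly_supported w" "\<And>x. 0 \<le> w x" "\<And>x. x \<in> K \<Longrightarrow> w x = 1"
  shows "measure M K \<le> (\<integral>x. w x \<partial>M)"
proof -
  have "measure M K = (\<integral>x. indicator K x \<partial>M)"
    using radon_measure_compact_sets[OF radon K] by simp
  also have "\<dots> \<le> (\<integral>x. w x \<partial>M)"
    by (intro integral_mono integrable_cs w integrable_indicator_compact radon K)
      (use w in \<open>auto simp: indicator_def\<close>)
  finally show ?thesis .
qed

text \<open>Inner regularity gives a compact subset of measure above \<open>s\<close>, and a Urysohn
  function is squeezed between it and \<open>U\<close>. The measure of \<open>U\<close> may be
  infinite, hence the auxiliary real \<open>r\<close>.\<close>

lemma open_approx_integral:
  assumes U: "open U" and r: "ennreal r \<le> emeasure M U" "s < r" "0 \<le> s"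
  obtains w where "compactly_supported w" "\<And>x. 0 \<le> w x" "\<And>x. w x \<le> 1"
    "\<And>x. x \<notin> U \<Longrightarrow> w x = 0" "s < (\<integral>x. w x \<partial>M)"
proof -
  have "ennreal s < emeasure M U"
    using r by (meson ennreal_lessI le_less_trans less_le_trans)
  then obtain K where K: "compact K" "K \<subseteq> U" "ennreal s < emeasure M K"
    unfolding emeasure_open[OF U] less_SUP_iff by auto
  have "s < measure M K"
    using K radon_measure_compact[OF radon K(1)] r
    by (metis emeasure_eq_ennreal_measure ennreal_less_iff infinity_ennreal_def less_irrefl)
  moreover obtain w where w: "compactly_supported w" "\<And>x. 0 \<le> w x" "\<And>x. w x \<le> 1"
    "\<And>x. x \<in> K \<Longrightarrow> w x = 1" "\<And>x. x \<notin> U \<Longrightarrow> w x = (0::real)"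
    using urysohn[OF K(1) U K(2)] by blast
  ultimately show ?thesis
    using measure_compact_le_integral[OF K(1) w(1,2,4)] that[OF w(1-3,5)] by simp
qed

text \<open>Supplies the normalising factor that is cancelled in the proof of inversion
  invariance.\<close>

lemma ex_positive_integral:
  obtains w where "compactly_supported w" "\<And>x. 0 \<le> w x" "\<And>x. w x \<le> 1" "0 < (\<integral>x. w x \<partial>M)"
proof -
  have "0 < emeasure M UNIV"
    using haar by (simp add: left_haar_measure_def zero_less_iff_neq_zero)
  then obtain r where r: "0 < r" "ennreal r \<le> emeasure M UNIV"
  proof (cases "emeasure M UNIV")
    case top
    then show ?thesis by (intro that[of 1]) auto
  qed (use that in auto)
  show ?thesis
    by (rule open_approx_integral[OF open_UNIV r(2,1) order_refl]) (rule that)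
qed

text \<open>Multiply by the integral of a test function \<open>g\<close>, translate so that both
  functions involve \<open>x\<close> and \<open>y\<close>, and interchange the integrals twice; left
  and right invariance then free the two factors again.\<close>

lemma integral_uminus_cs:
  assumes f: "compactly_supported f"
  shows "(\<integral>x. f (- x) \<partial>M) = (\<integral>x. f x \<partial>M)"
proof -
  obtain g where g: "compactly_supported g" "\<And>x. 0 \<le> g x" "0 < (\<integral>x. g x \<partial>M)"
    by (rule ex_positive_integral) blast
  note mg = measurable_cs[OF g(1)]
  have mg': "(\<lambda>x. f (- x)) \<in> borel_measurable borel"
    by (intro measurable_cs compactly_supported_uminus f)
  have "(\<integral>x. g x \<partial>M) * (\<integral>y. f (- y) \<partial>M) = (\<integral>x. g x * (\<integral>y. f (- y) \<partial>M) \<partial>M)"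
    using integrable_cs[OF g(1)] by simp
  also have "\<dots> = (\<integral>x. g x * (\<integral>y. f (- y + x) \<partial>M) \<partial>M)"
    using integral_left[OF mg', of "- x" for x] by (simp add: minus_add)
  also have "\<dots> = (\<integral>x. \<integral>y. g x * f (- y + x) \<partial>M \<partial>M)"
    by simp
  also have "\<dots> = (\<integral>y. \<integral>x. g x * f (- y + x) \<partial>M \<partial>M)"
    using integral_swap_compactly_supported[OF radon radon
        compactly_supported_convolution_kernel'[OF g(1) f]] by simp
  also have "\<dots> = (\<integral>y. \<integral>x. g (y + x) * f x \<partial>M \<partial>M)"
  proof (rule Bochner_Integration.integral_cong[OF refl])
    fix y
    have "(\<lambda>x. g x * f (- y + x)) \<in> borel_measurable borel"
      by (intro measurable_cs compactly_supported_mult_right compactly_supported_continuous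
          compactly_supported_left f g)
    from integral_left[OF this, of y]
    show "(\<integral>x. g x * f (- y + x) \<partial>M) = (\<integral>x. g (y + x) * f x \<partial>M)"
      by (simp add: add.assoc[symmetric])
  qed
  also have "\<dots> = (\<integral>x. \<integral>y. g (y + x) * f x \<partial>M \<partial>M)"
    using integral_swap_compactly_supported[OF radon radon
        compactly_supported_right_product[OF f g(1)]] by (simp add: mult.commute)
  \<comment> \<open>Unimodularity enters here: \<open>y\<close> is translated on the right by
    \<open>x\<close>.\<close>
  also have "\<dots> = (\<integral>x. (\<integral>y. g y \<partial>M) * f x \<partial>M)"
    using integral_right[OF mg] by simp
  also have "\<dots> = (\<integral>x. g x \<partial>M) * (\<integral>x. f x \<partial>M)"
    by simp
  finally show ?thesis using g by simp
qed

text \<open>A Urysohn function compares a compact set with an open set containing it; inner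
  regularity extends the inequality to open sets and outer regularity to Borel sets. Applied to
  \<open>A\<close> and to its reflection, it yields equality.\<close>

lemma emeasure_uminus_le:
  assumes A: "A \<in> sets borel"
  shows "emeasure M (uminus ` A) \<le> emeasure M A"
proof -
  have compact: "emeasure M (uminus ` K) \<le> emeasure M U" if K: "compact K" "open U" "K \<subseteq> U" for K U
  proof -
    obtain w where w: "compactly_supported w" "\<And>x. 0 \<le> w x" "\<And>x. w x \<le> 1"
      "\<And>x. x \<in> K \<Longrightarrow> w x = 1" "\<And>x. x \<notin> U \<Longrightarrow> w x = (0::real)"
      using urysohn[OF K] by blast
    have K': "compact (uminus ` K)"
      using K by (intro compact_continuous_image continuous_intros)
    have "emeasure M (uminus ` K) = ennreal (measure M (uminus ` K))"
      using radon_measure_compact[OF radon K'] by (intro emeasure_eq_ennreal_measure) auto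
    also have "\<dots> \<le> ennreal (\<integral>x. w (- x) \<partial>M)"
      by (intro ennreal_leI measure_compact_le_integral K' compactly_supported_uminus w) (use w in auto)
    also have "\<dots> = (\<integral>\<^sup>+x. ennreal (w x) \<partial>M)"
      unfolding integral_uminus_cs[OF w(1)]
      using integrable_cs[OF w(1)] w(2) by (simp add: nn_integral_eq_integral)
    also have "\<dots> \<le> (\<integral>\<^sup>+x. indicator U x \<partial>M)"
      by (intro nn_integral_mono) (use w in \<open>auto simp: indicator_def\<close>)
    also have "\<dots> = emeasure M U"
      using K by (intro nn_integral_indicator) simp
    finally show ?thesis .
  qed
  have "open": "emeasure M (uminus ` U) \<le> emeasure M U" if U: "open U" for U
  proof -
    have "uminus ` U = uminus -` U" by (force simp: image_iff)
    then have U': "open (uminus ` U)"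
      using open_vimage[OF U continuous_on_minus[OF continuous_on_id]] by simp
    show ?thesis
      unfolding emeasure_open[OF U']
    proof (rule SUP_least)
      fix K assume "K \<in> {K. compact K \<and> K \<subseteq> uminus ` U}"
      then have K: "compact K" "K \<subseteq> uminus ` U" by auto
      have "compact (uminus ` K)"
        using K by (intro compact_continuous_image continuous_intros)
      moreover have "uminus ` K \<subseteq> U" using K by force
      ultimately show "emeasure M K \<le> emeasure M U"
        using compact[of "uminus ` K" U] U by (simp add: image_image)
    qed
  qed
  show ?thesis
    unfolding emeasure_outer[OF A]
  proof (rule INF_greatest)
    fix U assume "U \<in> {U. open U \<and> A \<subseteq> U}"
    then have U: "open U" "A \<subseteq> U" by auto
    have "uminus ` U = uminus -` U" by (force simp: image_iff)
    then have "open (uminus ` U)"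
      using open_vimage[OF U(1) continuous_on_minus[OF continuous_on_id]] by simp
    then have "emeasure M (uminus ` A) \<le> emeasure M (uminus ` U)"
      by (intro emeasure_mono image_mono U) simp
    also have "\<dots> \<le> emeasure M U" by (rule "open"[OF U(1)])
    finally show "emeasure M (uminus ` A) \<le> emeasure M U" .
  qed
qed

lemma distr_uminus: "distr M M uminus = M"
proof (rule measure_eqI)
  fix A assume "A \<in> sets (distr M M uminus)"
  then have A: "A \<in> sets borel" by simp
  have m: "uminus \<in> measurable M M"
    by (intro continuous_measurable_M continuous_intros)
  have eq: "uminus -` A = uminus ` A" by (force simp: image_iff)
  have A': "uminus ` A \<in> sets borel"
    using measurable_sets[OF m, of A] A eq by simp
  have "emeasure M (uminus ` A) = emeasure M A"
    using emeasure_uminus_le[OF A] emeasure_uminus_le[OF A'] by (simp add: image_image)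
  then show "emeasure (distr M M uminus) A = emeasure M A"
    using A by (simp add: emeasure_distr[OF m] eq)
qed simp

lemma integral_uminus:
  fixes f :: "'a \<Rightarrow> real"
  assumes "f \<in> borel_measurable borel"
  shows "(\<integral>x. f (- x) \<partial>M) = (\<integral>x. f x \<partial>M)"
proof -
  have "(\<integral>x. f x \<partial>M) = (\<integral>x. f x \<partial>distr M M uminus)"
    by (simp only: distr_uminus)
  also have "\<dots> = (\<integral>x. f (- x) \<partial>M)"
    using assms by (intro integral_distr continuous_measurable_M continuous_intros) (simp add: measurable_M)
  finally show ?thesis ..
qed

text \<open>The map \<open>h \<mapsto> - h + x\<close> is the left translation by \<open>- x\<close>
  followed by inversion. It is the substitution needed for the second factor of a
  convolution.\<close>

lemma integral_reflect:
  fixes f :: "'a \<Rightarrow> real"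
  assumes f: "f \<in> borel_measurable borel"
  shows "(\<integral>h. f (- h + x) \<partial>M) = (\<integral>x. f x \<partial>M)"
proof -
  have "(\<lambda>y. f (- y)) \<in> borel_measurable borel"
    by (intro measurable_compose[OF _ f] borel_measurable_continuous_onI continuous_intros)
  from integral_left[OF this, of "- x"] show ?thesis
    by (simp add: minus_add integral_uminus[OF f])
qed

lemma integrable_reflect:
  fixes f :: "'a \<Rightarrow> real"
  assumes f: "integrable M f"
  shows "integrable M (\<lambda>h. f (- h + x))"
proof -
  have 1: "integrable M (\<lambda>y. f (- y))"
    by (rule integrable_distr[of uminus M M])
      (auto simp: distr_uminus f intro!: continuous_measurable_M continuous_intros)
  have "integrable M (\<lambda>y. f (- (- x + y)))"
    by (rule integrable_distr[of "\<lambda>y. - x + y" M M "\<lambda>y. f (- y)"])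
      (auto simp: distr_left 1 intro!: continuous_measurable_M continuous_intros)
  then show ?thesis by (simp add: minus_add)
qed

section \<open>Continuity of translation in the L1-norm and density of compactly supported
  functions\<close>

text \<open>The cutoff \<open>w\<close> near 0 makes the difference compactly supported in
  \<open>(v, x)\<close> jointly, so that its integral over \<open>x\<close> is continuous in
  \<open>v\<close>; this integral vanishes at \<open>v = 0\<close>.\<close>

lemma translation_continuous_L1:
  fixes f :: "'a \<Rightarrow> real"
  assumes f: "compactly_supported f" and e: "e > 0"
  obtains V where "open V" "0 \<in> V" "\<And>v. v \<in> V \<Longrightarrow> (\<integral>x. \<bar>f (v + x) - f x\<bar> \<partial>M) \<le> e"
proof -
  obtain w :: "'a \<Rightarrow> real" where w: "compactly_supported w" "\<And>x. 0 \<le> w x" "\<And>x. w x \<le> 1"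
    and "\<And>x. x \<in> {0} \<Longrightarrow> w x = 1"
    by (rule urysohn[OF compact_sing[of 0] open_UNIV subset_UNIV]) blast
  then have w0: "w 0 = 1" by simp
  define D where "D = (\<lambda>(v, x). \<bar>w v * f (v + x) - w v * f x\<bar>)"
  have D: "compactly_supported D"
    using compactly_supported_abs[OF compactly_supported_diff[OF
        compactly_supported_left_product[OF w(1) f] compactly_supported_product[OF w(1) f]]]
    by (simp add: D_def case_prod_unfold)
  define I where "I v = (\<integral>x. D (v, x) \<partial>M)" for v
  have I: "continuous_on UNIV I"
    unfolding I_def by (intro compactly_supported_continuous compactly_supported_integral radon D)
  \<comment> \<open>Where \<open>w\<close> exceeds 1/2, removing the weight costs at most a factor
    2.\<close>
  define V where "V = {v. 1 / 2 < w v} \<inter> {v. I v < e / 2}"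
  show ?thesis
  proof (rule that[of V])
    show "open V" unfolding V_def
      by (intro open_Int open_Collect_less I compactly_supported_continuous w continuous_on_const)
    show "0 \<in> V" using w0 e by (simp add: V_def I_def D_def)
    show "(\<integral>x. \<bar>f (v + x) - f x\<bar> \<partial>M) \<le> e" if v: "v \<in> V" for v
    proof -
      have "I v = (\<integral>x. w v * \<bar>f (v + x) - f x\<bar> \<partial>M)"
        using w(2)[of v] unfolding I_def D_def
        by (simp add: abs_mult right_diff_distrib[symmetric])
      also have "\<dots> = w v * (\<integral>x. \<bar>f (v + x) - f x\<bar> \<partial>M)" by simp
      finally have eq: "I v = w v * (\<integral>x. \<bar>f (v + x) - f x\<bar> \<partial>M)" .
      have "1 / 2 * (\<integral>x. \<bar>f (v + x) - f x\<bar> \<partial>M) \<le> w v * (\<integral>x. \<bar>f (v + x) - f x\<bar> \<partial>M)"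
        using v by (intro mult_right_mono) (auto simp: V_def)
      then show ?thesis using v unfolding eq[symmetric] V_def by simp
    qed
  qed
qed

text \<open>By induction over integrable functions: indicator functions are handled by regularity
  and Urysohn functions, sums by adding approximants, limits by dominated convergence.\<close>

lemma cs_dense:
  assumes "integrable M (f :: 'a \<Rightarrow> real)"
  shows "\<forall>e>0. \<exists>p. compactly_supported p \<and> (\<integral>x. \<bar>f x - p x\<bar> \<partial>M) \<le> e"
  using assms
proof (induction rule: integrable_induct)
  case (base A c)
  show ?case
  proof (intro allI impI)
    fix e :: real assume e: "e > 0"
    define d where "d = e / (2 * (\<bar>c\<bar> + 1))"
    have d: "d > 0" "\<bar>c\<bar> * (2 * d) \<le> e" using e by (auto simp: d_def field_simps)
    have A: "A \<in> sets borel" using base by simp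
    have "emeasure M A < emeasure M A + ennreal d"
      using base d by (simp add: ennreal_add_left_cancel_less less_top[symmetric])
    then obtain U where U: "open U" "A \<subseteq> U" "emeasure M U < emeasure M A + ennreal d"
      by (subst (asm) emeasure_outer[OF A]) (auto simp: INF_less_iff)
    have Ufin: "emeasure M U < \<infinity>"
      using U(3) base(2) by (metis ennreal_add_less_top ennreal_less_top infinity_ennreal_def less_trans)
    have mU: "measure M U < measure M A + d"
    proof -
      have "ennreal (measure M U) < ennreal (measure M A) + ennreal d"
        using U(3) Ufin base(2) by (simp add: emeasure_eq_ennreal_measure less_top)
      then show ?thesis
        using d by (simp add: ennreal_plus[symmetric] ennreal_less_iff del: ennreal_plus)
    qed
    obtain K where K: "compact K" "K \<subseteq> U" "measure M U - d < measure M K"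
    proof (cases "measure M U - d < 0")
      case True
      then show ?thesis using that[of "{}"] by simp
    next
      case False
      then have "ennreal (measure M U - d) < emeasure M U"
        using Ufin d by (subst emeasure_eq_ennreal_measure) (auto simp: ennreal_less_iff)
      then obtain K where K: "compact K" "K \<subseteq> U" "ennreal (measure M U - d) < emeasure M K"
        unfolding emeasure_open[OF U(1)] less_SUP_iff by auto
      have "measure M U - d < measure M K"
        using K False radon_measure_compact[OF radon K(1)]
        by (subst (asm) emeasure_eq_ennreal_measure) (auto simp: ennreal_less_iff)
      with K show ?thesis using that by blast
    qed
    obtain w where w: "compactly_supported w" "\<And>x. 0 \<le> w x" "\<And>x. w x \<le> 1"
      "\<And>x. x \<in> K \<Longrightarrow> w x = 1" "\<And>x. x \<notin> U \<Longrightarrow> w x = (0::real)"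
      using urysohn[OF K(1) U(1) K(2)] by blast
    have iU: "integrable M (indicator U :: _ \<Rightarrow> real)" using U Ufin by (intro integrable_real_indicator) auto
    have iA: "integrable M (indicator A :: _ \<Rightarrow> real)" using base by (intro integrable_real_indicator) auto
    have iK: "integrable M (indicator K :: _ \<Rightarrow> real)" by (rule integrable_indicator_compact[OF radon K(1)])
    \<comment> \<open>Both functions are 1 on the intersection of \<open>A\<close> and
      \<open>K\<close> and 0 outside \<open>U\<close>; what remains of \<open>U\<close> misses
      \<open>A\<close> or \<open>K\<close>.\<close>
    have "(\<integral>x. \<bar>indicator A x - w x\<bar> \<partial>M) \<le>
        (\<integral>x. (indicator U x - indicator A x) + (indicator U x - indicator K x) \<partial>M)"
    proof (rule integral_mono)
      show "\<bar>indicator A x - w x\<bar> \<le> (indicator U x - indicator A x) + (indicator U x - indicator K x)" for x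
        using U(2) K(2) w(2-5)[of x] by (auto simp: indicator_def abs_if)
    qed (use iU iA iK integrable_cs[OF w(1)] in auto)
    also have "\<dots> = (measure M U - measure M A) + (measure M U - measure M K)"
      using iU iA iK U(1) A K(1) by (simp add: compact_imp_closed)
    also have "\<dots> \<le> 2 * d" using mU K(3) by simp
    finally have le: "(\<integral>x. \<bar>indicator A x - w x\<bar> \<partial>M) \<le> 2 * d" .
    have "(\<integral>x. \<bar>indicator A x *\<^sub>R c - c * w x\<bar> \<partial>M) = (\<integral>x. \<bar>c\<bar> * \<bar>indicator A x - w x\<bar> \<partial>M)"
      by (intro Bochner_Integration.integral_cong refl)
        (simp add: abs_mult[symmetric] right_diff_distrib mult.commute)
    also have "\<dots> = \<bar>c\<bar> * (\<integral>x. \<bar>indicator A x - w x\<bar> \<partial>M)" by simp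
    also have "\<dots> \<le> \<bar>c\<bar> * (2 * d)" by (intro mult_left_mono le) simp
    also have "\<dots> \<le> e" by (rule d)
    finally show "\<exists>p. compactly_supported p \<and> (\<integral>x. \<bar>indicator A x *\<^sub>R c - p x\<bar> \<partial>M) \<le> e"
      using compactly_supported_cmult[OF w(1)] by blast
  qed
next
  case (add f g)
  show ?case
  proof (intro allI impI)
    fix e :: real assume e: "e > 0"
    obtain p where p: "compactly_supported p" "(\<integral>x. \<bar>f x - p x\<bar> \<partial>M) \<le> e / 2"
      using add.IH e half_gt_zero by blast
    obtain q where q: "compactly_supported q" "(\<integral>x. \<bar>g x - q x\<bar> \<partial>M) \<le> e / 2"
      using add.IH e half_gt_zero by blast
    note i = add.hyps integrable_cs[OF p(1)] integrable_cs[OF q(1)]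
    have "(\<integral>x. \<bar>(f x + g x) - (p x + q x)\<bar> \<partial>M) \<le> (\<integral>x. \<bar>f x - p x\<bar> + \<bar>g x - q x\<bar> \<partial>M)"
      by (intro integral_mono) (use i in auto)
    also have "\<dots> = (\<integral>x. \<bar>f x - p x\<bar> \<partial>M) + (\<integral>x. \<bar>g x - q x\<bar> \<partial>M)"
      using i by (intro Bochner_Integration.integral_add) auto
    finally show "\<exists>p. compactly_supported p \<and> (\<integral>x. \<bar>(f x + g x) - p x\<bar> \<partial>M) \<le> e"
      using compactly_supported_add[OF p(1) q(1)] p q by force
  qed
next
  case (lim f s)
  show ?case
  proof (intro allI impI)
    fix e :: real assume e: "e > 0"
    have "(\<lambda>i. \<integral>x. \<bar>f x - s i x\<bar> \<partial>M) \<longlonglongrightarrow> (\<integral>x. 0 \<partial>M)"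
    proof (rule integral_dominated_convergence)
      \<comment> \<open>The induction principle bounds the approximants by
        \<open>2 * \<bar>f x\<bar>\<close>, whence the factor 3 for the difference.\<close>
      show "integrable M (\<lambda>x. 3 * \<bar>f x\<bar>)" using lim by auto
      show "AE x in M. (\<lambda>i. \<bar>f x - s i x\<bar>) \<longlonglongrightarrow> 0"
      proof (rule AE_I2)
        fix x assume "x \<in> space M"
        then have "(\<lambda>i. f x - s i x) \<longlonglongrightarrow> f x - f x"
          by (intro tendsto_intros lim.hyps)
        then show "(\<lambda>i. \<bar>f x - s i x\<bar>) \<longlonglongrightarrow> 0"
          by (simp add: tendsto_rabs_zero)
      qed
      show "AE x in M. norm \<bar>f x - s i x\<bar> \<le> 3 * \<bar>f x\<bar>" for i
      proof (rule AE_I2)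
        fix x assume "x \<in> space M"
        then have "norm (s i x) \<le> 2 * norm (f x)" by (rule lim.hyps)
        then show "norm \<bar>f x - s i x\<bar> \<le> 3 * \<bar>f x\<bar>" by simp
      qed
    qed (use lim.hyps in auto)
    then have "(\<lambda>i. \<integral>x. \<bar>f x - s i x\<bar> \<partial>M) \<longlonglongrightarrow> 0" by simp
    then have "\<forall>\<^sub>F i in sequentially. (\<integral>x. \<bar>f x - s i x\<bar> \<partial>M) < e / 2"
      by (rule order_tendstoD) (use e in simp)
    then obtain i where i: "(\<integral>x. \<bar>f x - s i x\<bar> \<partial>M) < e / 2"
      unfolding eventually_sequentially by blast
    obtain p where p: "compactly_supported p" "(\<integral>x. \<bar>s i x - p x\<bar> \<partial>M) \<le> e / 2"
      using lim.IH e half_gt_zero by blast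
    note int = lim.hyps(1)[of i] lim.hyps(4) integrable_cs[OF p(1)]
    have "(\<integral>x. \<bar>f x - p x\<bar> \<partial>M) \<le> (\<integral>x. \<bar>f x - s i x\<bar> + \<bar>s i x - p x\<bar> \<partial>M)"
      by (intro integral_mono) (use int in auto)
    also have "\<dots> = (\<integral>x. \<bar>f x - s i x\<bar> \<partial>M) + (\<integral>x. \<bar>s i x - p x\<bar> \<partial>M)"
      using int by (intro Bochner_Integration.integral_add) auto
    finally show "\<exists>p. compactly_supported p \<and> (\<integral>x. \<bar>f x - p x\<bar> \<partial>M) \<le> e"
      using i p by force
  qed
qed

section \<open>The trilinear form and translations\<close>

definition unit_function :: "('a \<Rightarrow> real) \<Rightarrow> bool" where
  "unit_function f \<longleftrightarrow> compactly_supported f \<and> (\<forall>x. 0 \<le> f x \<and> f x \<le> 1)"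

lemma unit_functionI:
  "compactly_supported f \<Longrightarrow> (\<And>x. 0 \<le> f x) \<Longrightarrow> (\<And>x. f x \<le> 1) \<Longrightarrow> unit_function f"
  by (simp add: unit_function_def)

lemma unit_functionD:
  assumes "unit_function f"
  shows "compactly_supported f" "0 \<le> f x" "f x \<le> 1" "continuous_on UNIV f" "integrable M f"
    "f \<in> borel_measurable borel"
  using assms compactly_supported_continuous integrable_cs measurable_cs
  by (auto simp: unit_function_def)

lemma unit_function_integral_nonneg: "unit_function f \<Longrightarrow> 0 \<le> (\<integral>x. f x \<partial>M)"
  by (simp add: unit_functionD)

lemma unit_function_left: "unit_function f \<Longrightarrow> unit_function (\<lambda>x. f (g + x))"
  by (simp add: unit_function_def compactly_supported_left)

text \<open>For compactly supported \<open>p\<close> and \<open>q\<close> and continuous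
  \<open>k\<close> this is the integral of \<open>q\<close> against the convolution of
  \<open>p\<close> and \<open>k\<close>. The kernel is kept general so that \<open>1 - k\<close>,
  which need not have compact support, can take its place.\<close>

definition pairing :: "('a \<Rightarrow> real) \<Rightarrow> ('a \<Rightarrow> real) \<Rightarrow> ('a \<Rightarrow> real) \<Rightarrow> real" where
  "pairing k p q = (\<integral>h. \<integral>x. p h * q x * k (- h + x) \<partial>M \<partial>M)"

lemma pairing_kernel:
  assumes k: "continuous_on UNIV k" and p: "compactly_supported p" and q: "compactly_supported q"
  shows "compactly_supported (\<lambda>(h, x). p h * q x * k (- h + x :: 'a))"
proof -
  have "continuous_on UNIV (\<lambda>z::'a \<times> 'a. k (- fst z + snd z))"
    by (rule continuous_on_compose2[OF k]) (auto intro!: continuous_intros)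
  from compactly_supported_mult_right[OF compactly_supported_product[OF p q] this]
  show ?thesis by (simp add: case_prod_unfold)
qed

lemma pairing_integrable:
  assumes "continuous_on UNIV k" "compactly_supported p" "compactly_supported q"
  shows "integrable M (\<lambda>x. p h * q x * k (- h + x))"
    "integrable M (\<lambda>h. \<integral>x. p h * q x * k (- h + x) \<partial>M)"
    "integrable M (\<lambda>h. p h * q x * k (- h + x))"
    "integrable M (\<lambda>x. \<integral>h. p h * q x * k (- h + x) \<partial>M)"
proof -
  note c = pairing_kernel[OF assms]
  show "integrable M (\<lambda>x. p h * q x * k (- h + x))"
    using integrable_cs[OF compactly_supported_section(1)[OF c, of h]] by simp
  show "integrable M (\<lambda>h. p h * q x * k (- h + x))"
    using integrable_cs[OF compactly_supported_section(2)[OF c, of x]] by simp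
  show "integrable M (\<lambda>h. \<integral>x. p h * q x * k (- h + x) \<partial>M)"
    using integrable_cs[OF compactly_supported_integral[OF radon c]] by simp
  show "integrable M (\<lambda>x. \<integral>h. p h * q x * k (- h + x) \<partial>M)"
    using integrable_cs[OF compactly_supported_integral[OF radon compactly_supported_swap[OF c]]] by simp
qed

lemma pairing_swap:
  assumes "continuous_on UNIV k" "compactly_supported p" "compactly_supported q"
  shows "pairing k p q = (\<integral>x. \<integral>h. p h * q x * k (- h + x) \<partial>M \<partial>M)"
  unfolding pairing_def
  using integral_swap_compactly_supported[OF radon radon pairing_kernel[OF assms]] by simp

text \<open>Rearrangement compares sums of two products pointwise in \<open>(h, x)\<close>;
  integrating against a nonnegative kernel preserves the comparison.\<close>

lemma pairing_add_mono:
  assumes k: "continuous_on UNIV k" "\<And>x. 0 \<le> k x"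
    and cs: "compactly_supported p1" "compactly_supported p2" "compactly_supported p3" "compactly_supported p4"
      "compactly_supported q1" "compactly_supported q2" "compactly_supported q3" "compactly_supported q4"
    and le: "\<And>h x. p1 h * q1 x + p2 h * q2 x \<le> p3 h * q3 x + p4 h * q4 x"
  shows "pairing k p1 q1 + pairing k p2 q2 \<le> pairing k p3 q3 + pairing k p4 q4"
proof -
  note i = pairing_integrable(1,2)[OF k(1)]
  have "(\<integral>h. (\<integral>x. p1 h * q1 x * k (- h + x) \<partial>M) + (\<integral>x. p2 h * q2 x * k (- h + x) \<partial>M) \<partial>M)
      \<le> (\<integral>h. (\<integral>x. p3 h * q3 x * k (- h + x) \<partial>M) + (\<integral>x. p4 h * q4 x * k (- h + x) \<partial>M) \<partial>M)"
  proof (intro integral_mono Bochner_Integration.integrable_add i cs)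
    fix h
    have "(\<integral>x. p1 h * q1 x * k (- h + x) + p2 h * q2 x * k (- h + x) \<partial>M)
        \<le> (\<integral>x. p3 h * q3 x * k (- h + x) + p4 h * q4 x * k (- h + x) \<partial>M)"
    proof (intro integral_mono Bochner_Integration.integrable_add i cs)
      show "p1 h * q1 x * k (- h + x) + p2 h * q2 x * k (- h + x)
          \<le> p3 h * q3 x * k (- h + x) + p4 h * q4 x * k (- h + x)" for x
        using mult_right_mono[OF le[of h x] k(2)[of "- h + x"]] by (simp add: algebra_simps)
    qed
    then show "(\<integral>x. p1 h * q1 x * k (- h + x) \<partial>M) + (\<integral>x. p2 h * q2 x * k (- h + x) \<partial>M)
      \<le> (\<integral>x. p3 h * q3 x * k (- h + x) \<partial>M) + (\<integral>x. p4 h * q4 x * k (- h + x) \<partial>M)"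
      by (subst (asm) (1 2) Bochner_Integration.integral_add) (intro i cs)+
  qed
  then show ?thesis
    unfolding pairing_def
    by (subst (asm) (1 2) Bochner_Integration.integral_add) (intro i cs)+
qed

text \<open>The kernel sees only \<open>- h + x\<close>, which is unchanged when \<open>h\<close>
  and \<open>x\<close> are both translated by \<open>g\<close> on the left.\<close>

lemma pairing_left:
  assumes k: "continuous_on UNIV k" and p: "compactly_supported p" and q: "compactly_supported q"
  shows "pairing k (\<lambda>h. p (g + h)) (\<lambda>x. q (g + x)) = pairing k p q"
proof -
  let ?F = "\<lambda>h. \<integral>x. p h * q x * k (- h + x) \<partial>M"
  have "(\<integral>x. p (g + h) * q (g + x) * k (- h + x) \<partial>M) = ?F (g + h)" for h
  proof -
    have "(\<lambda>x. p (g + h) * q x * k (- (g + h) + x)) \<in> borel_measurable borel"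
      using measurable_cs[OF compactly_supported_section(1)[OF pairing_kernel[OF k p q], of "g + h"]]
      by simp
    moreover have "- (g + h) + (g + x) = - h + x" for x
      by (simp add: minus_add add.assoc del: add_uminus_conv_diff)
    ultimately show ?thesis
      using integral_left[of "\<lambda>x. p (g + h) * q x * k (- (g + h) + x)" g] by simp
  qed
  moreover have "?F \<in> borel_measurable borel"
    using measurable_cs[OF compactly_supported_integral[OF radon pairing_kernel[OF k p q]]] by simp
  ultimately show ?thesis
    unfolding pairing_def using integral_left[of ?F g] by simp
qed

lemma pairing_nonneg:
  assumes "\<And>x. 0 \<le> k x" "\<And>x. 0 \<le> p x" "\<And>x. 0 \<le> q x"
  shows "0 \<le> pairing k p q"
  unfolding pairing_def by (intro integral_nonneg_AE AE_I2 mult_nonneg_nonneg assms)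

lemma pairing_complement:
  assumes "unit_function k" "unit_function p" "unit_function q"
  shows "pairing (\<lambda>x. 1 - k x) p q = (\<integral>x. p x \<partial>M) * (\<integral>x. q x \<partial>M) - pairing k p q"
proof -
  note u = assms[THEN unit_functionD(1)]
  note i = pairing_integrable(1,2)[OF compactly_supported_continuous[OF u(1)] u(2,3)]
  note j = integrable_cs[OF u(2)] integrable_cs[OF u(3)]
  have "(\<integral>x. p h * q x * (1 - k (- h + x)) \<partial>M) = p h * (\<integral>x. q x \<partial>M) - (\<integral>x. p h * q x * k (- h + x) \<partial>M)" for h
    using i(1)[of h] j by (simp add: right_diff_distrib)
  then show ?thesis
    unfolding pairing_def using i(2) j by simp
qed

text \<open>Estimate \<open>q\<close> by 1 and use left invariance in \<open>x\<close>. Together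
  with its counterpart for \<open>p\<close>, this gives the bounds near two sides of the square in
  the maximum principle.\<close>

lemma pairing_le_mult1:
  assumes "unit_function k" "unit_function p" "unit_function q"
  shows "pairing k p q \<le> (\<integral>x. p x \<partial>M) * (\<integral>x. k x \<partial>M)"
proof -
  note k = unit_functionD[OF assms(1)] and p = unit_functionD[OF assms(2)] and q = unit_functionD[OF assms(3)]
  have "pairing k p q \<le> (\<integral>h. p h * (\<integral>x. k x \<partial>M) \<partial>M)"
    unfolding pairing_def
  proof (intro integral_mono pairing_integrable k p q integrable_mult_left)
    fix h
    have "(\<integral>x. p h * q x * k (- h + x) \<partial>M) \<le> (\<integral>x. p h * k (- h + x) \<partial>M)"
    proof (intro integral_mono pairing_integrable k p q integrable_mult_right
        integrable_cs compactly_supported_left)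
      show "p h * q x * k (- h + x) \<le> p h * k (- h + x)" for x
        by (intro mult_right_mono mult_left_le k p q)
    qed
    also have "\<dots> = p h * (\<integral>x. k x \<partial>M)"
      by (simp add: integral_left[OF k(6)])
    finally show "(\<integral>x. p h * q x * k (- h + x) \<partial>M) \<le> p h * (\<integral>x. k x \<partial>M)" .
  qed
  then show ?thesis by simp
qed

text \<open>Here \<open>p\<close> is estimated by 1 and \<open>h\<close> is integrated first, which
  requires the reflected form of invariance.\<close>

lemma pairing_le_mult2:
  assumes "unit_function k" "unit_function p" "unit_function q"
  shows "pairing k p q \<le> (\<integral>x. q x \<partial>M) * (\<integral>x. k x \<partial>M)"
proof -
  note k = unit_functionD[OF assms(1)] and p = unit_functionD[OF assms(2)] and q = unit_functionD[OF assms(3)]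
  have "pairing k p q \<le> (\<integral>x. q x * (\<integral>x. k x \<partial>M) \<partial>M)"
    unfolding pairing_swap[OF k(4) p(1) q(1)]
  proof (intro integral_mono pairing_integrable k p q integrable_mult_left)
    fix x
    have "(\<integral>h. p h * q x * k (- h + x) \<partial>M) \<le> (\<integral>h. q x * k (- h + x) \<partial>M)"
    proof (intro integral_mono pairing_integrable k p q integrable_mult_right integrable_reflect)
      show "p h * q x * k (- h + x) \<le> q x * k (- h + x)" for h
        by (intro mult_right_mono mult_left_le_one_le k p q)
    qed
    also have "\<dots> = q x * (\<integral>x. k x \<partial>M)"
      by (simp add: integral_reflect[OF k(6)])
    finally show "(\<integral>h. p h * q x * k (- h + x) \<partial>M) \<le> q x * (\<integral>x. k x \<partial>M)" .
  qed
  then show ?thesis by simp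
qed

section \<open>Splitting a function and its translate\<close>

text \<open>The least mass that can be moved: the loss in replacing \<open>f\<close> by its minimum
  with the translate, the largest function below both.\<close>

definition lower_shift :: "('a \<Rightarrow> real) \<Rightarrow> 'a \<Rightarrow> real" where
  "lower_shift f g = (\<integral>x. f x \<partial>M) - (\<integral>x. min (f x) (f (g + x)) \<partial>M)"

text \<open>The greatest mass that can be moved: \<open>max 0 (f x + f (g + x) - 1)\<close> is the
  least nonnegative function whose complement in \<open>f x + f (g + x)\<close> stays below 1. For
  indicator functions the two shifts coincide.\<close>

definition upper_shift :: "('a \<Rightarrow> real) \<Rightarrow> 'a \<Rightarrow> real" where
  "upper_shift f g = (\<integral>x. f x \<partial>M) - (\<integral>x. max 0 (f x + f (g + x) - 1) \<partial>M)"

lemma unit_function_min_left: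
  assumes f: "unit_function f" shows "unit_function (\<lambda>x. min (f x) (f (g + x)))"
  by (intro unit_functionI compactly_supported_min compactly_supported_left unit_functionD(1)[OF f])
    (use unit_functionD(2,3)[OF f] in \<open>auto simp: min_le_iff_disj\<close>)

lemma unit_function_excess:
  assumes f: "unit_function f" shows "unit_function (\<lambda>x. max 0 (f x + f (g + x) - 1))"
proof (intro unit_functionI)
  show "compactly_supported (\<lambda>x. max 0 (f x + f (g + x) - 1))"
    by (rule compactly_supported_compose2[where F = "\<lambda>u v. max 0 (u + v - 1)"])
      (auto intro!: unit_functionD(1)[OF f] compactly_supported_left continuous_intros simp: split_beta)
  show "max 0 (f x + f (g + x) - 1) \<le> 1" for x
    using unit_functionD(3)[OF f, of x] unit_functionD(3)[OF f, of "g + x"] by simp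
qed simp

lemma lower_shift_zero: "lower_shift f 0 = 0"
  by (simp add: lower_shift_def)

lemma lower_shift_nonneg:
  assumes f: "unit_function f" shows "0 \<le> lower_shift f g"
  unfolding lower_shift_def diff_ge_0_iff_ge
  by (intro integral_mono unit_functionD(5) unit_function_min_left f) simp

lemma lower_le_upper_shift:
  assumes f: "unit_function f" shows "lower_shift f g \<le> upper_shift f g"
proof -
  have "max 0 (f x + f (g + x) - 1) \<le> min (f x) (f (g + x))" for x
    using unit_functionD(2,3)[OF f, of x] unit_functionD(2,3)[OF f, of "g + x"] by auto
  then have "(\<integral>x. max 0 (f x + f (g + x) - 1) \<partial>M) \<le> (\<integral>x. min (f x) (f (g + x)) \<partial>M)"
    by (intro integral_mono unit_functionD(5) unit_function_min_left unit_function_excess f)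
  then show ?thesis by (simp add: lower_shift_def upper_shift_def)
qed

text \<open>The two minima differ by at most \<open>\<bar>f (v + (g + x)) - f (g + x)\<bar>\<close>,
  and left invariance removes \<open>g\<close> from the integral of this bound.\<close>

lemma lower_shift_step:
  assumes f: "unit_function f" and v: "(\<integral>x. \<bar>f (v + x) - f x\<bar> \<partial>M) \<le> d"
  shows "lower_shift f (v + g) \<le> lower_shift f g + d"
proof -
  note fl = unit_function_left[OF f]
  have m: "(\<lambda>x. \<bar>f (v + x) - f x\<bar>) \<in> borel_measurable borel"
    using unit_functionD(6)[OF fl, of v] unit_functionD(6)[OF f] by simp
  have i: "integrable M (\<lambda>x. \<bar>f (v + (g + x)) - f (g + x)\<bar>)"
    using unit_functionD(5)[OF fl, of "v + g"] unit_functionD(5)[OF fl, of g]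
    by (simp add: add.assoc)
  have "(\<integral>x. min (f x) (f (g + x)) \<partial>M)
      \<le> (\<integral>x. min (f x) (f (v + g + x)) + \<bar>f (v + (g + x)) - f (g + x)\<bar> \<partial>M)"
    by (intro integral_mono Bochner_Integration.integrable_add unit_functionD(5) unit_function_min_left f i)
      (auto simp: add.assoc)
  also have "\<dots> = (\<integral>x. min (f x) (f (v + g + x)) \<partial>M) + (\<integral>x. \<bar>f (v + (g + x)) - f (g + x)\<bar> \<partial>M)"
    by (intro Bochner_Integration.integral_add unit_functionD(5) unit_function_min_left f i)
  also have "(\<integral>x. \<bar>f (v + (g + x)) - f (g + x)\<bar> \<partial>M) = (\<integral>x. \<bar>f (v + x) - f x\<bar> \<partial>M)"
    using integral_left[OF m, of g] .
  finally show ?thesis using v by (simp add: lower_shift_def)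
qed

text \<open>Expanding \<open>(1 - f x) * (1 - f (g + x)) \<ge> 0\<close> replaces the truncated sum
  by a product, whose average over \<open>g\<close> can be computed.\<close>

lemma upper_shift_ge:
  assumes f: "unit_function f"
  shows "(\<integral>x. f x \<partial>M) - (\<integral>x. f x * f (g + x) \<partial>M) \<le> upper_shift f g"
proof -
  have "max 0 (f x + f (g + x) - 1) \<le> f x * f (g + x)" for x
  proof -
    have "0 \<le> (1 - f x) * (1 - f (g + x))" "0 \<le> f x * f (g + x)"
      using unit_functionD(2,3)[OF f] by auto
    then show ?thesis by (simp add: algebra_simps)
  qed
  then have "(\<integral>x. max 0 (f x + f (g + x) - 1) \<partial>M) \<le> (\<integral>x. f x * f (g + x) \<partial>M)"
    by (intro integral_mono unit_functionD(5) unit_function_excess f integrable_cs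
        compactly_supported_mult_right unit_functionD(1,4) unit_function_left)
  then show ?thesis by (simp add: upper_shift_def)
qed

text \<open>Convex combinations of the two extreme choices of \<open>p\<close> realise every mass in
  between; \<open>q\<close> is the complement in the sum.\<close>

lemma shift_split:
  assumes f: "unit_function f" and \<alpha>: "lower_shift f g \<le> \<alpha>" "\<alpha> \<le> upper_shift f g"
  obtains p q where "unit_function p" "unit_function q" "\<And>x. p x \<le> min (f x) (f (g + x))"
    "\<And>x. p x + q x = f x + f (g + x)"
    "(\<integral>x. p x \<partial>M) = (\<integral>x. f x \<partial>M) - \<alpha>" "(\<integral>x. q x \<partial>M) = (\<integral>x. f x \<partial>M) + \<alpha>"
proof -
  let ?l = "lower_shift f g" and ?r = "upper_shift f g"
  \<comment> \<open>The weight solves the linear equation for \<open>\<alpha>\<close>. If the two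
    shifts agree, \<open>\<alpha>\<close> is their common value and weight 0 realises it.\<close>
  define s where "s = (if ?l = ?r then 0 else (\<alpha> - ?l) / (?r - ?l))"
  have s: "0 \<le> s" "s \<le> 1" "(1 - s) * ?l + s * ?r = \<alpha>"
    using \<alpha> by (auto simp: s_def field_simps)
  define p where "p x = (1 - s) * min (f x) (f (g + x)) + s * max 0 (f x + f (g + x) - 1)" for x
  define q where "q x = f x + f (g + x) - p x" for x
  note fl = unit_function_left[OF f] and fm = unit_function_min_left[OF f] and fe = unit_function_excess[OF f]
  note u = unit_functionD(2,3)[OF f]
  have em: "max 0 (f x + f (g + x) - 1) \<le> min (f x) (f (g + x))" for x
    using u[of x] u[of "g + x"] by auto
  have p1: "p x \<le> min (f x) (f (g + x))" for x
    unfolding p_def by (rule convex_bound_le) (use em s in auto)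
  have p2: "max 0 (f x + f (g + x) - 1) \<le> p x" for x
  proof -
    have "max 0 (f x + f (g + x) - 1) =
        (1 - s) * max 0 (f x + f (g + x) - 1) + s * max 0 (f x + f (g + x) - 1)"
      by (simp add: left_diff_distrib)
    also have "\<dots> \<le> p x"
      unfolding p_def by (intro add_right_mono mult_left_mono em) (use s in auto)
    finally show ?thesis .
  qed
  have csp: "compactly_supported p"
    unfolding p_def
    by (intro compactly_supported_add compactly_supported_cmult unit_functionD(1) fm fe)
  have up: "unit_function p"
  proof (rule unit_functionI[OF csp])
    show "0 \<le> p x" for x using p2[of x] by simp
    show "p x \<le> 1" for x using p1[of x] u[of x] by simp
  qed
  have csq: "compactly_supported q"
    unfolding q_def
    by (intro compactly_supported_add compactly_supported_diff csp unit_functionD(1) f fl)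
  have uq: "unit_function q"
  proof (rule unit_functionI[OF csq])
    show "0 \<le> q x" for x using p1[of x] u[of x] u[of "g + x"] by (simp add: q_def)
    show "q x \<le> 1" for x using p2[of x] by (simp add: q_def)
  qed
  have "(\<integral>x. p x \<partial>M) = (1 - s) * (\<integral>x. min (f x) (f (g + x)) \<partial>M) + s * (\<integral>x. max 0 (f x + f (g + x) - 1) \<partial>M)"
    unfolding p_def using unit_functionD(5)[OF fm] unit_functionD(5)[OF fe] by simp
  also have "\<dots> = (1 - s) * ((\<integral>x. f x \<partial>M) - ?l) + s * ((\<integral>x. f x \<partial>M) - ?r)"
    by (simp add: lower_shift_def upper_shift_def)
  also have "\<dots> = (\<integral>x. f x \<partial>M) - ((1 - s) * ?l + s * ?r)"
    by (simp add: algebra_simps)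
  finally have ip: "(\<integral>x. p x \<partial>M) = (\<integral>x. f x \<partial>M) - \<alpha>" using s by simp
  have "(\<integral>x. q x \<partial>M) = (\<integral>x. f x \<partial>M) + (\<integral>x. f (g + x) \<partial>M) - (\<integral>x. p x \<partial>M)"
    unfolding q_def using unit_functionD(5)[OF f] unit_functionD(5)[OF fl, of g] unit_functionD(5)[OF up] by simp
  then have iq: "(\<integral>x. q x \<partial>M) = (\<integral>x. f x \<partial>M) + \<alpha>"
    using ip integral_left[OF unit_functionD(6)[OF f]] by simp
  show ?thesis
    by (rule that[OF up uq p1 _ ip iq]) (simp add: q_def)
qed

text \<open>Pointwise, the gain is \<open>(f h - p h) * (f' x - p' x)\<close> plus the same product
  for the translates, and both products are nonnegative. The pairing of the two translates equals
  the original one, whence the factor 2.\<close>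

lemma pairing_exchange:
  assumes k: "continuous_on UNIV k" "\<And>x. 0 \<le> k x"
    and f: "unit_function f" "unit_function p" "unit_function q"
      "\<And>x. p x \<le> min (f x) (f (g + x))" "\<And>x. p x + q x = f x + f (g + x)"
    and f': "unit_function f'" "unit_function p'" "unit_function q'"
      "\<And>x. p' x \<le> min (f' x) (f' (g + x))" "\<And>x. p' x + q' x = f' x + f' (g + x)"
  shows "pairing k q p' + pairing k p q' \<le> 2 * pairing k f f'"
proof -
  have "pairing k q p' + pairing k p q' \<le>
      pairing k f f' + pairing k (\<lambda>h. f (g + h)) (\<lambda>x. f' (g + x))"
  proof (intro pairing_add_mono k unit_functionD(1) f(1-3) f'(1-3) unit_function_left)
    fix h x
    have q: "q h = f h + f (g + h) - p h" "q' x = f' x + f' (g + x) - p' x"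
      using f(5)[of h] f'(5)[of x] by simp_all
    have "0 \<le> (f h - p h) * (f' x - p' x)" "0 \<le> (f (g + h) - p h) * (f' (g + x) - p' x)"
      using f(4)[of h] f'(4)[of x] by simp_all
    then show "q h * p' x + p h * q' x \<le> f h * f' x + f (g + h) * f' (g + x)"
      unfolding q by (simp add: algebra_simps)
  qed
  then show ?thesis
    using pairing_left[OF k(1) unit_functionD(1)[OF f(1)] unit_functionD(1)[OF f'(1)]] by simp
qed

section \<open>Averaging over translates\<close>

lemma compactly_supported_weighted_translate:
  assumes f: "compactly_supported f" and w: "compactly_supported w"
  shows "compactly_supported (\<lambda>(g, x :: 'a). f x * (w g * f (g + x)))"
proof -
  have "continuous_on UNIV (\<lambda>z::'a \<times> 'a. f (snd z))"
    by (rule continuous_on_compose2[OF compactly_supported_continuous[OF f]])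
      (auto intro!: continuous_intros)
  from compactly_supported_mult_left[OF compactly_supported_left_product[OF w f] this]
  show ?thesis by (simp add: case_prod_unfold)
qed

lemma integral_weighted_translate:
  "(\<integral>x. f x * (w g * f (g + x)) \<partial>M) = (w g :: real) * (\<integral>x. f x * f (g + x) \<partial>M)"
  unfolding integral_mult_right_zero[symmetric] by (simp only: mult.left_commute)

text \<open>The weight provides the compact support needed for interchanging the integrals.
  Afterwards it is estimated by 1, and right invariance gives the integral of
  \<open>f (g + x)\<close> over \<open>g\<close>.\<close>

lemma average_translates:
  assumes f: "unit_function f" and w: "unit_function w"
  shows "(\<integral>g. w g * (\<integral>x. f x * f (g + x) \<partial>M) \<partial>M) \<le> (\<integral>x. f x \<partial>M)\<^sup>2"
proof -
  note u = unit_functionD[OF f] and uw = unit_functionD[OF w]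
  have c: "compactly_supported (\<lambda>(g, x). f x * (w g * f (g + x)))"
    by (rule compactly_supported_weighted_translate[OF u(1) uw(1)])
  have "(\<integral>g. w g * (\<integral>x. f x * f (g + x) \<partial>M) \<partial>M) = (\<integral>g. \<integral>x. f x * (w g * f (g + x)) \<partial>M \<partial>M)"
    by (simp only: integral_weighted_translate)
  also have "\<dots> = (\<integral>x. \<integral>g. f x * (w g * f (g + x)) \<partial>M \<partial>M)"
    using integral_swap_compactly_supported[OF radon radon c] by simp
  also have "\<dots> \<le> (\<integral>x. f x * (\<integral>x. f x \<partial>M) \<partial>M)"
  proof (intro integral_mono integrable_mult_left u)
    show "integrable M (\<lambda>x. \<integral>g. f x * (w g * f (g + x)) \<partial>M)"
      using integrable_cs[OF compactly_supported_integral[OF radon compactly_supported_swap[OF c]]] by simp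
    fix x
    have cr: "compactly_supported (\<lambda>g. f (g + x))"
    proof -
      obtain K where K: "compact K" "\<And>x. x \<notin> K \<Longrightarrow> f x = 0"
        using u(1) by (rule compactly_supportedE) blast
      show ?thesis
      proof (rule compactly_supportedI)
        show "continuous_on UNIV (\<lambda>g. f (g + x))"
          by (rule continuous_on_compose2[OF u(4)]) (auto intro!: continuous_intros)
        show "compact ((\<lambda>y. y + - x) ` K)"
          using K by (intro compact_continuous_image continuous_intros)
        show "f (g + x) = 0" if "g \<notin> (\<lambda>y. y + - x) ` K" for g
          using that by (intro K(2)) (force simp: image_iff add.assoc)
      qed
    qed
    have "(\<integral>g. f x * (w g * f (g + x)) \<partial>M) \<le> (\<integral>g. f x * f (g + x) \<partial>M)"
    proof (intro integral_mono integrable_mult_right integrable_cs cr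
        compactly_supported_mult_left uw compactly_supported_continuous)
      show "f x * (w g * f (g + x)) \<le> f x * f (g + x)" for g
        by (intro mult_left_mono mult_left_le_one_le u uw)
    qed
    also have "\<dots> = f x * (\<integral>x. f x \<partial>M)"
      by (simp add: integral_right[OF u(6)])
    finally show "(\<integral>g. f x * (w g * f (g + x)) \<partial>M) \<le> f x * (\<integral>x. f x \<partial>M)" .
  qed
  finally show ?thesis by (simp add: power2_eq_square)
qed

text \<open>A small upper shift on \<open>H\<close> forces the correlation of \<open>f\<close> with
  its translate to exceed the mass of \<open>f\<close> minus \<open>e\<close> there; averaging
  against weights supported in \<open>H\<close> bounds these correlations from above.\<close>

lemma upper_shift_average:
  assumes f: "unit_function f" and H: "open H" "ennreal \<mu> \<le> emeasure M H" "0 < \<mu>"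
    and less: "\<And>g. g \<in> H \<Longrightarrow> upper_shift f g < e"
  shows "((\<integral>x. f x \<partial>M) - e) * \<mu> \<le> (\<integral>x. f x \<partial>M)\<^sup>2"
proof (cases "(\<integral>x. f x \<partial>M) - e \<le> 0")
  case True
  then have "((\<integral>x. f x \<partial>M) - e) * \<mu> \<le> 0" using H by (intro mult_nonpos_nonneg) auto
  then show ?thesis by (rule order_trans) simp
next
  case False
  let ?a = "\<integral>x. f x \<partial>M"
  have "s * (?a - e) \<le> ?a\<^sup>2" if s: "0 < s" "s < \<mu>" for s
  proof -
    obtain w where w: "compactly_supported w" "\<And>x. 0 \<le> w x" "\<And>x. w x \<le> 1"
      "\<And>x. x \<notin> H \<Longrightarrow> w x = 0" "s < (\<integral>x. w x \<partial>M)"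
      using open_approx_integral[OF H(1,2) s(2)] s(1) by (metis less_imp_le)
    have w': "unit_function w" by (intro unit_functionI w)
    have "s * (?a - e) \<le> (\<integral>x. w x \<partial>M) * (?a - e)"
      using w(5) False by (intro mult_right_mono) auto
    also have "\<dots> = (\<integral>g. w g * (?a - e) \<partial>M)" by simp
    also have "\<dots> \<le> (\<integral>g. w g * (\<integral>x. f x * f (g + x) \<partial>M) \<partial>M)"
    proof (intro integral_mono integrable_mult_left integrable_cs w)
      from compactly_supported_integral[OF radon
          compactly_supported_weighted_translate[OF unit_functionD(1)[OF f] w(1)]]
      show "compactly_supported (\<lambda>g. w g * (\<integral>x. f x * f (g + x) \<partial>M))"
        by (simp add: integral_weighted_translate)
      show "w g * (?a - e) \<le> w g * (\<integral>x. f x * f (g + x) \<partial>M)" for g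
      proof (cases "g \<in> H")
        case True
        then show ?thesis
          using less[OF True] upper_shift_ge[OF f, of g] by (intro mult_left_mono w) simp
      qed (simp add: w)
    qed
    also have "\<dots> \<le> ?a\<^sup>2" by (rule average_translates[OF f w'])
    finally show ?thesis .
  qed
  \<comment> \<open>Weights are available with mass above any \<open>s < \<mu>\<close>; letting
    \<open>s\<close> tend to \<open>\<mu>\<close> gives the claim.\<close>
  then have "s \<le> ?a\<^sup>2 / (?a - e)" if "0 < s" "s < \<mu>" for s
    using False that by (subst pos_le_divide_eq) auto
  then have "\<mu> \<le> ?a\<^sup>2 / (?a - e)"
    by (rule dense_le_bounded[OF H(3)])
  then show ?thesis using False by (simp add: field_simps)
qed

section \<open>The maximum principle\<close>

text \<open>
  If no \<open>g\<close> as claimed existed, then both \<open>upper_shift\<close>s would stay below \<open>e\<close> along every chain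
  of small translations, hence on a whole open subgroup; averaging over that subgroup excludes this.
\<close>

lemma ex_moderate_shift:
  assumes f: "unit_function f" and f': "unit_function f'"
    and \<mu>: "0 < \<mu>" "\<And>H. open H \<Longrightarrow> is_subgroup H \<Longrightarrow> ennreal \<mu> \<le> emeasure M H"
    and e: "0 < e" "(\<integral>x. f x \<partial>M)\<^sup>2 < ((\<integral>x. f x \<partial>M) - e) * \<mu>" and d: "0 < d"
  shows "\<exists>g. lower_shift f g \<le> e + d \<and> lower_shift f' g \<le> e + d \<and>
    (e \<le> upper_shift f g \<or> e \<le> upper_shift f' g)"
proof (rule ccontr)
  assume "\<not> ?thesis"
  then have none: "upper_shift f g < e \<and> upper_shift f' g < e"
    if "lower_shift f g \<le> e + d" "lower_shift f' g \<le> e + d" for g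
    using that by (meson not_le)
  obtain V where V: "open V" "0 \<in> V" "\<And>v. v \<in> V \<Longrightarrow> (\<integral>x. \<bar>f (v + x) - f x\<bar> \<partial>M) \<le> d"
    using translation_continuous_L1[OF unit_functionD(1)[OF f] d] by blast
  obtain V' where V': "open V'" "0 \<in> V'" "\<And>v. v \<in> V' \<Longrightarrow> (\<integral>x. \<bar>f' (v + x) - f' x\<bar> \<partial>M) \<le> d"
    using translation_continuous_L1[OF unit_functionD(1)[OF f'] d] by blast
  \<comment> \<open>Symmetrised, so that \<open>W\<close> generates a subgroup; its letters move
    both functions by at most \<open>d\<close>.\<close>
  define W where "W = (V \<inter> V') \<inter> uminus -` (V \<inter> V')"
  have "open (uminus -` (V \<inter> V'))"
    by (intro open_vimage open_Int V V' continuous_intros)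
  then have W: "open W" "0 \<in> W" "\<And>v. v \<in> W \<Longrightarrow> - v \<in> W"
    using V V' by (auto simp: W_def)
  have small: "upper_shift f g < e \<and> upper_shift f' g < e" if "g \<in> generated_subgroup W" for g
    using that
  proof induction
    case zero
    show ?case using e d by (intro none) (simp_all add: lower_shift_zero)
  next
    case (step v g)
    have v: "(\<integral>x. \<bar>f (v + x) - f x\<bar> \<partial>M) \<le> d" "(\<integral>x. \<bar>f' (v + x) - f' x\<bar> \<partial>M) \<le> d"
      using step V V' by (auto simp: W_def)
    \<comment> \<open>A further letter raises the lower shifts by at most \<open>d\<close>. They
      were below \<open>e\<close> because the upper shifts were, so they stay below
      \<open>e + d\<close> and \<open>none\<close> applies again.\<close>
    show ?case
      using lower_shift_step[OF f v(1), of g] lower_shift_step[OF f' v(2), of g]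
        lower_le_upper_shift[OF f, of g] lower_le_upper_shift[OF f', of g] step.IH
      by (intro none) auto
  qed
  have "((\<integral>x. f x \<partial>M) - e) * \<mu> \<le> (\<integral>x. f x \<partial>M)\<^sup>2"
    using small
    by (intro upper_shift_average[OF f generated_subgroup_open[OF W(1,2)]] \<mu>
        generated_subgroup_open generated_subgroup_is_subgroup W) auto
  with e show False by simp
qed

text \<open>
  The difference of the two sides satisfies the midpoint inequality along the moves
  \<open>(a \<plusminus> \<alpha>, c \<minusplus> \<gamma>)\<close> of the two masses provided by \<open>shift_split\<close> and \<open>pairing_exchange\<close>,
  because the left-hand side is affine in \<open>a + c\<close>.  As it is nonpositive on the boundary of the square
  \<open>[0, \<mu>]\<^sup>2\<close>, the maximum principle applies; adding \<open>\<eta> * (a\<^sup>2 + c\<^sup>2)\<close> makes the midpoint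
  inequality strict, so that near-maximisers suffice.
\<close>

lemma pairing_complement_lower_bound:
  assumes k: "unit_function k" and p0: "unit_function p0" and q0: "unit_function q0"
    and \<mu>: "0 < \<mu>" "\<And>H. open H \<Longrightarrow> is_subgroup H \<Longrightarrow> ennreal \<mu> \<le> emeasure M H"
    and le: "(\<integral>x. k x \<partial>M) \<le> \<mu>" "(\<integral>x. p0 x \<partial>M) \<le> \<mu>" "(\<integral>x. q0 x \<partial>M) \<le> \<mu>"
  shows "((\<integral>x. p0 x \<partial>M) + (\<integral>x. q0 x \<partial>M) - \<mu>) * (\<mu> - (\<integral>x. k x \<partial>M)) \<le> pairing (\<lambda>x. 1 - k x) p0 q0"
proof (rule ccontr)
  define I where "I f = (\<integral>x. f x \<partial>M)" for f :: "'a \<Rightarrow> real"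
  define b where "b = I k"
  \<comment> \<open>The amount by which the inequality fails; it is assumed positive at
    \<open>(p0, q0)\<close>.\<close>
  define \<Phi> where "\<Phi> p q = (I p + I q - \<mu>) * (\<mu> - b) - pairing (\<lambda>x. 1 - k x) p q" for p q
  assume "\<not> ?thesis"
  then have v0: "0 < \<Phi> p0 q0" by (simp add: \<Phi>_def I_def b_def)
  have b: "0 \<le> b" "b \<le> \<mu>"
    using le unit_function_integral_nonneg[OF k] by (auto simp: b_def I_def)
  have I0: "0 \<le> I f" if "unit_function f" for f
    using unit_function_integral_nonneg[OF that] by (simp add: I_def)
  have bounds: "\<Phi> p q \<le> (\<mu> - I p) * \<mu>" "\<Phi> p q \<le> (\<mu> - I q) * \<mu>" "\<Phi> p q \<le> I p * \<mu>" "\<Phi> p q \<le> I q * \<mu>"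
    if p: "unit_function p" and q: "unit_function q" and m: "I p \<le> \<mu>" "I q \<le> \<mu>" for p q
  proof -
    have eq: "\<Phi> p q = (I p + I q - \<mu>) * (\<mu> - b) - I p * I q + pairing k p q"
      unfolding \<Phi>_def I_def using pairing_complement[OF k p q] by simp
    have "\<Phi> p q \<le> (\<mu> - I p) * (b + I q - \<mu>)"
      using pairing_le_mult2[OF k p q] unfolding eq I_def[symmetric] b_def[symmetric]
      by (simp add: algebra_simps)
    also have "\<dots> \<le> (\<mu> - I p) * \<mu>"
      using m b by (intro mult_left_mono) auto
    finally show "\<Phi> p q \<le> (\<mu> - I p) * \<mu>" .
    have "\<Phi> p q \<le> (\<mu> - I q) * (b + I p - \<mu>)"
      using pairing_le_mult1[OF k p q] unfolding eq I_def[symmetric] b_def[symmetric]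
      by (simp add: algebra_simps)
    also have "\<dots> \<le> (\<mu> - I q) * \<mu>"
      using m b by (intro mult_left_mono) auto
    finally show "\<Phi> p q \<le> (\<mu> - I q) * \<mu>" .
    have "0 \<le> pairing (\<lambda>x. 1 - k x) p q"
      by (intro pairing_nonneg) (use unit_functionD(2,3)[OF k] unit_functionD(2)[OF p] unit_functionD(2)[OF q] in auto)
    then have le: "\<Phi> p q \<le> (I p + I q - \<mu>) * (\<mu> - b)" by (simp add: \<Phi>_def)
    also have "\<dots> \<le> I p * (\<mu> - b)" using m b by (intro mult_right_mono) auto
    also have "\<dots> \<le> I p * \<mu>" using I0[OF p] b by (intro mult_left_mono) auto
    finally show "\<Phi> p q \<le> I p * \<mu>" .
    note le
    also have "(I p + I q - \<mu>) * (\<mu> - b) \<le> I q * (\<mu> - b)" using m b by (intro mult_right_mono) auto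
    also have "\<dots> \<le> I q * \<mu>" using I0[OF q] b by (intro mult_left_mono) auto
    finally show "\<Phi> p q \<le> I q * \<mu>" .
  qed
  define v where "v = \<Phi> p0 q0"
  \<comment> \<open>\<open>\<rho>\<close> is the distance to the boundary forced by
    \<open>\<Phi> > v / 4\<close>. \<open>\<eta>\<close> keeps the quadratic perturbation below
    \<open>v / 2\<close> on the square. \<open>e\<close> satisfies
    \<open>e * \<mu> = \<rho>\<^sup>2 / 2\<close>, as the choice of a translation requires.\<close>
  define \<rho> where "\<rho> = v / (4 * \<mu>)"
  define \<eta> where "\<eta> = v / (4 * \<mu>\<^sup>2)"
  define e where "e = \<rho>\<^sup>2 / (2 * \<mu>)"
  have pos: "0 < v" "0 < \<rho>" "0 < \<eta>" "0 < e"
    using v0 \<mu> by (auto simp: v_def \<rho>_def \<eta>_def e_def)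
  have pert: "\<eta> * ((I p)\<^sup>2 + (I q)\<^sup>2) \<le> v / 2" "0 \<le> \<eta> * ((I p)\<^sup>2 + (I q)\<^sup>2)"
    if "unit_function p" "unit_function q" "I p \<le> \<mu>" "I q \<le> \<mu>" for p q
  proof -
    have "(I p)\<^sup>2 \<le> \<mu>\<^sup>2" "(I q)\<^sup>2 \<le> \<mu>\<^sup>2"
      using that by (auto intro!: power_mono I0)
    then have "\<eta> * ((I p)\<^sup>2 + (I q)\<^sup>2) \<le> \<eta> * (2 * \<mu>\<^sup>2)"
      using pos by (intro mult_left_mono) auto
    also have "\<dots> = v / 2" using \<mu> by (simp add: \<eta>_def)
    finally show "\<eta> * ((I p)\<^sup>2 + (I q)\<^sup>2) \<le> v / 2" .
    show "0 \<le> \<eta> * ((I p)\<^sup>2 + (I q)\<^sup>2)" using pos by simp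
  qed
  define \<Psi> where "\<Psi> p q = \<Phi> p q + \<eta> * ((I p)\<^sup>2 + (I q)\<^sup>2)" for p q
  define S where "S = {\<Psi> p q | p q. unit_function p \<and> unit_function q \<and> I p \<le> \<mu> \<and> I q \<le> \<mu>}"
  have SI: "\<Psi> p q \<in> S" if "unit_function p" "unit_function q" "I p \<le> \<mu>" "I q \<le> \<mu>" for p q
    unfolding S_def using that by blast
  have bdd: "bdd_above S"
  proof (rule bdd_aboveI)
    fix s assume "s \<in> S"
    then obtain p q where s: "s = \<Psi> p q" and pq: "unit_function p" "unit_function q" "I p \<le> \<mu>" "I q \<le> \<mu>"
      unfolding S_def by blast
    have "I p * \<mu> \<le> \<mu> * \<mu>" using pq \<mu> by (intro mult_right_mono) auto
    then show "s \<le> \<mu> * \<mu> + v / 2"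
      using bounds(3)[OF pq] pert(1)[OF pq] by (simp add: s \<Psi>_def)
  qed
  have "\<Psi> p0 q0 \<in> S" by (rule SI) (use p0 q0 le in \<open>auto simp: I_def\<close>)
  moreover have "v \<le> \<Psi> p0 q0"
    using pert(2)[of p0 q0] p0 q0 le by (simp add: \<Psi>_def v_def I_def)
  ultimately have V: "v \<le> Sup S" using cSup_upper[OF _ bdd] order_trans by blast
  \<comment> \<open>Being within \<open>v / 4\<close> of the supremum keeps \<open>\<Phi>\<close>
    above \<open>v / 4\<close>; being within \<open>\<eta> * e\<^sup>2\<close> contradicts the
    strict gain below.\<close>
  define \<kappa> where "\<kappa> = min (v / 4) (\<eta> * e\<^sup>2)"
  have \<kappa>: "0 < \<kappa>" "\<kappa> \<le> v / 4" "\<kappa> \<le> \<eta> * e\<^sup>2"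
    using pos by (auto simp: \<kappa>_def)
  have "Sup S - \<kappa> < Sup S" using \<kappa> by simp
  then obtain s where "s \<in> S" "Sup S - \<kappa> < s"
    using less_cSup_iff[OF _ bdd] \<open>\<Psi> p0 q0 \<in> S\<close> by blast
  then obtain p q where pq: "unit_function p" "unit_function q" "I p \<le> \<mu>" "I q \<le> \<mu>"
    and near: "Sup S - \<kappa> < \<Psi> p q"
    unfolding S_def by blast
  have "v / 4 < \<Phi> p q"
    using near V \<kappa>(2) pert(1)[OF pq] pos unfolding \<Psi>_def by linarith
  then have "v / 4 < I p * \<mu>" "v / 4 < I q * \<mu>" "v / 4 < (\<mu> - I p) * \<mu>" "v / 4 < (\<mu> - I q) * \<mu>"
    using bounds[OF pq] by linarith+
  \<comment> \<open>Moves of both masses by at most \<open>\<rho>\<close> therefore stay inside the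
    square.\<close>
  then have interior: "\<rho> < I p" "\<rho> < I q" "\<rho> < \<mu> - I p" "\<rho> < \<mu> - I q"
    using \<mu> by (auto simp: \<rho>_def field_simps)
  have e_le: "e \<le> \<rho> / 2"
  proof -
    have "\<rho> * \<rho> \<le> \<rho> * \<mu>" using interior pos by (intro mult_left_mono) auto
    then show ?thesis using \<mu> by (simp add: e_def power2_eq_square field_simps)
  qed
  \<comment> \<open>Equivalent to \<open>e * \<mu> < I p * (\<mu> - I p)\<close>, a product of two
    factors larger than \<open>\<rho>\<close>.\<close>
  have "(I p)\<^sup>2 < (I p - e) * \<mu>"
  proof -
    have "\<rho> * \<rho> < I p * (\<mu> - I p)"
      using interior pos by (intro mult_strict_mono) auto
    moreover have "e * \<mu> = \<rho> * \<rho> / 2" using \<mu> by (simp add: e_def power2_eq_square)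
    moreover have "0 < \<rho> * \<rho>" using pos by simp
    ultimately show ?thesis by (simp add: power2_eq_square algebra_simps)
  qed
  then obtain g where g: "lower_shift p g \<le> e + \<rho> / 2" "lower_shift q g \<le> e + \<rho> / 2"
    "e \<le> upper_shift p g \<or> e \<le> upper_shift q g"
    using ex_moderate_shift[OF pq(1,2) \<mu> pos(4), of "\<rho> / 2"] pos(2) unfolding I_def by auto
  \<comment> \<open>\<open>e\<close> is clamped to the admissible interval of shifts. The step is at
    most \<open>\<rho>\<close> since the lower shift is, and is at least \<open>e\<close> if the
    upper shift is.\<close>
  define \<alpha> where "\<alpha> = max (lower_shift p g) (min (upper_shift p g) e)"
  define \<gamma> where "\<gamma> = max (lower_shift q g) (min (upper_shift q g) e)"
  have \<alpha>: "lower_shift p g \<le> \<alpha>" "\<alpha> \<le> upper_shift p g" "0 \<le> \<alpha>" "\<alpha> \<le> \<rho>"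
    using lower_le_upper_shift[OF pq(1), of g] lower_shift_nonneg[OF pq(1), of g] g e_le pos
    by (auto simp: \<alpha>_def)
  have \<gamma>: "lower_shift q g \<le> \<gamma>" "\<gamma> \<le> upper_shift q g" "0 \<le> \<gamma>" "\<gamma> \<le> \<rho>"
    using lower_le_upper_shift[OF pq(2), of g] lower_shift_nonneg[OF pq(2), of g] g e_le pos
    by (auto simp: \<gamma>_def)
  have "e \<le> \<alpha> \<or> e \<le> \<gamma>" using g(3) by (auto simp: \<alpha>_def \<gamma>_def)
  then have step: "e\<^sup>2 \<le> \<alpha>\<^sup>2 + \<gamma>\<^sup>2"
  proof
    assume "e \<le> \<alpha>"
    then have "e\<^sup>2 \<le> \<alpha>\<^sup>2" using pos by (intro power_mono) auto
    then show ?thesis by (simp add: add_increasing2)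
  next
    assume "e \<le> \<gamma>"
    then have "e\<^sup>2 \<le> \<gamma>\<^sup>2" using pos by (intro power_mono) auto
    then show ?thesis by (simp add: add_increasing)
  qed
  obtain p1 p2 where p: "unit_function p1" "unit_function p2" "\<And>x. p1 x \<le> min (p x) (p (g + x))"
    "\<And>x. p1 x + p2 x = p x + p (g + x)" "I p1 = I p - \<alpha>" "I p2 = I p + \<alpha>"
    using shift_split[OF pq(1) \<alpha>(1,2)] unfolding I_def by blast
  obtain q1 q2 where q: "unit_function q1" "unit_function q2" "\<And>x. q1 x \<le> min (q x) (q (g + x))"
    "\<And>x. q1 x + q2 x = q x + q (g + x)" "I q1 = I q - \<gamma>" "I q2 = I q + \<gamma>"
    using shift_split[OF pq(2) \<gamma>(1,2)] unfolding I_def by blast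
  \<comment> \<open>The enlarged function of one pair meets the reduced function of the other, so
    the changes of \<open>I p + I q\<close> cancel between the two terms.\<close>
  have "pairing (\<lambda>x. 1 - k x) p2 q1 + pairing (\<lambda>x. 1 - k x) p1 q2 \<le> 2 * pairing (\<lambda>x. 1 - k x) p q"
    by (rule pairing_exchange[OF _ _ pq(1) p(1-4) pq(2) q(1-4)])
      (use unit_functionD(3,4)[OF k] in \<open>auto intro!: continuous_intros\<close>)
  then have "2 * \<Phi> p q \<le> \<Phi> p2 q1 + \<Phi> p1 q2"
    unfolding \<Phi>_def p(5,6) q(5,6) by (simp add: algebra_simps)
  \<comment> \<open>Parallelogram identity: the squares add \<open>2 * \<alpha>\<^sup>2\<close> and
    \<open>2 * \<gamma>\<^sup>2\<close>, which makes the midpoint inequality strict.\<close>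
  then have "2 * \<Psi> p q + 2 * (\<eta> * (\<alpha>\<^sup>2 + \<gamma>\<^sup>2)) \<le> \<Psi> p2 q1 + \<Psi> p1 q2"
    unfolding \<Psi>_def p(5,6) q(5,6) by (simp add: power2_eq_square algebra_simps)
  moreover have "\<Psi> p2 q1 \<le> Sup S" "\<Psi> p1 q2 \<le> Sup S"
    by (intro cSup_upper[OF _ bdd] SI; use p q \<alpha> \<gamma> interior pos in linarith)+
  moreover have "\<eta> * e\<^sup>2 \<le> \<eta> * (\<alpha>\<^sup>2 + \<gamma>\<^sup>2)"
    using step pos by (intro mult_left_mono) auto
  ultimately show False using near \<kappa>(3) by linarith
qed

text \<open>The bound for \<open>1 - k\<close> rewritten so that the mass of \<open>q\<close> enters
  linearly; in the application its coefficient is \<open>t\<close>.\<close>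

lemma pairing_upper_bound:
  assumes k: "unit_function k" and p: "unit_function p" and q: "unit_function q"
    and \<mu>: "0 < \<mu>" "\<And>H. open H \<Longrightarrow> is_subgroup H \<Longrightarrow> ennreal \<mu> \<le> emeasure M H"
    and le: "(\<integral>x. k x \<partial>M) \<le> \<mu>" "(\<integral>x. p x \<partial>M) \<le> \<mu>" "(\<integral>x. q x \<partial>M) \<le> \<mu>"
  shows "pairing k p q \<le> (\<mu> - (\<integral>x. p x \<partial>M)) * (\<mu> - (\<integral>x. k x \<partial>M))
    + ((\<integral>x. p x \<partial>M) + (\<integral>x. k x \<partial>M) - \<mu>) * (\<integral>x. q x \<partial>M)"
  using pairing_complement_lower_bound[OF assms] unfolding pairing_complement[OF k p q]
  by (simp add: algebra_simps)

section \<open>Convolutions of integrable functions\<close>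

lemma cutoff_eq_max: "cutoff t y = max 0 (y - t)"
  by (simp add: cutoff_def)

lemma compactly_supported_convolution:
  assumes p: "compactly_supported p" and k: "compactly_supported k"
  shows "compactly_supported (convolution M p k)"
  using compactly_supported_integral[OF radon
      compactly_supported_swap[OF compactly_supported_convolution_kernel[OF p k]]]
  by (simp add: convolution_def[abs_def])

lemma pairing_eq_convolution:
  assumes k: "continuous_on UNIV k" and p: "compactly_supported p" and q: "compactly_supported q"
  shows "pairing k p q = (\<integral>x. q x * convolution M p k x \<partial>M)"
  unfolding pairing_swap[OF assms] convolution_def integral_mult_right_zero[symmetric]
  by (simp only: mult.left_commute mult.assoc)

section \<open>Approximation of integrable functions and of their convolutions\<close>

text \<open>Truncation to the unit interval does not increase the distance to \<open>f\<close>. The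
  mass is kept from exceeding that of \<open>f\<close>, so that bounds by \<open>\<mu>\<close> pass
  to the approximant.\<close>

lemma unit_function_approx:
  assumes f: "integrable M f" "\<And>x. f x \<in> {0..1}" and e: "0 < e"
  obtains p where "unit_function p" "(\<integral>x. \<bar>f x - p x\<bar> \<partial>M) \<le> e" "(\<integral>x. p x \<partial>M) \<le> (\<integral>x. f x \<partial>M)"
proof -
  obtain p0 where p0: "compactly_supported p0" "(\<integral>x. \<bar>f x - p0 x\<bar> \<partial>M) \<le> e / 2"
    using cs_dense[OF f(1)] e half_gt_zero by blast
  define q where "q x = min 1 (max 0 (p0 x))" for x
  have q: "unit_function q"
  proof (rule unit_functionI)
    show "compactly_supported q"
      unfolding q_def
      by (rule compactly_supported_compose[OF p0(1), of "\<lambda>y. min 1 (max 0 y)"])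
        (auto intro!: continuous_intros)
  qed (auto simp: q_def)
  have iq: "integrable M q" by (rule unit_functionD(5)[OF q])
  have "(\<integral>x. \<bar>f x - q x\<bar> \<partial>M) \<le> (\<integral>x. \<bar>f x - p0 x\<bar> \<partial>M)"
  proof (intro integral_mono)
    show "\<bar>f x - q x\<bar> \<le> \<bar>f x - p0 x\<bar>" for x
      using f(2)[of x] by (auto simp: q_def min_def max_def)
  qed (use f integrable_cs[OF p0(1)] iq in auto)
  with p0 have qe: "(\<integral>x. \<bar>f x - q x\<bar> \<partial>M) \<le> e / 2" by simp
  let ?a = "\<integral>x. f x \<partial>M" and ?b = "\<integral>x. q x \<partial>M"
  have a: "0 \<le> ?a" using f by (intro integral_nonneg_AE AE_I2) auto
  show ?thesis
  proof (cases "?b \<le> ?a")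
    case True
    show ?thesis by (rule that[OF q _ True]) (use qe e in simp)
  next
    case False
    \<comment> \<open>Scaling down to the mass of \<open>f\<close> costs exactly the excess mass,
      which is at most \<open>e / 2\<close>.\<close>
    define s where "s = ?a / ?b"
    have s: "0 \<le> s" "s \<le> 1" "s * ?b = ?a" using False a by (auto simp: s_def)
    have u: "unit_function (\<lambda>x. s * q x)"
      by (intro unit_functionI compactly_supported_cmult unit_functionD[OF q] mult_nonneg_nonneg s
          mult_le_one)
    have "?b - ?a \<le> e / 2"
    proof -
      have "?b - ?a = (\<integral>x. q x - f x \<partial>M)" using iq f by simp
      also have "\<dots> \<le> (\<integral>x. \<bar>f x - q x\<bar> \<partial>M)"
        by (intro integral_mono) (use iq f in auto)
      finally show ?thesis using qe by simp
    qed
    moreover have "(\<integral>x. \<bar>f x - s * q x\<bar> \<partial>M) \<le> (\<integral>x. \<bar>f x - q x\<bar> + (q x - s * q x) \<partial>M)"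
    proof (intro integral_mono)
      show "\<bar>f x - s * q x\<bar> \<le> \<bar>f x - q x\<bar> + (q x - s * q x)" for x
        using mult_left_le_one_le[OF unit_functionD(2)[OF q, of x] s(1,2)] by simp
    qed (use iq f in auto)
    moreover have "(\<integral>x. \<bar>f x - q x\<bar> + (q x - s * q x) \<partial>M) = (\<integral>x. \<bar>f x - q x\<bar> \<partial>M) + (?b - ?a)"
      using iq f s by simp
    ultimately have "(\<integral>x. \<bar>f x - s * q x\<bar> \<partial>M) \<le> e" using qe by simp
    then show ?thesis by (rule that[OF u]) (use s in simp)
  qed
qed

lemma integrable_convolution_integrand:
  fixes f1 f2 :: "'a \<Rightarrow> real"
  assumes f1: "integrable M f1" and f2: "f2 \<in> borel_measurable borel" "\<And>x. f2 x \<in> {0..1}"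
  shows "integrable M (\<lambda>h. f1 h * f2 (- h + x))"
proof (rule Bochner_Integration.integrable_bound[OF f1])
  have "(\<lambda>h. f2 (- h + x)) \<in> borel_measurable M"
    unfolding measurable_M[symmetric]
    by (intro measurable_compose[OF _ f2(1)] borel_measurable_continuous_onI continuous_intros)
  then show "(\<lambda>h. f1 h * f2 (- h + x)) \<in> borel_measurable M" using f1 by simp
  have "\<bar>f1 h\<bar> * \<bar>f2 (- h + x)\<bar> \<le> \<bar>f1 h\<bar>" for h
    using f2(2)[of "- h + x"] by (intro mult_left_le) auto
  then show "AE h in M. norm (f1 h * f2 (- h + x)) \<le> norm (f1 h)"
    by (simp add: abs_mult)
qed

text \<open>Change one factor at a time; the factor kept fixed is at most 1, and reflection removes
  \<open>x\<close> from the second error. Hence L1-approximation of the factors is uniform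
  approximation of the convolution.\<close>

lemma convolution_close:
  assumes f1: "integrable M f1" "\<And>x. f1 x \<in> {0..1}" and f2: "integrable M f2" "\<And>x. f2 x \<in> {0..1}"
    and p1: "unit_function p1" and p2: "unit_function p2"
  shows "\<bar>convolution M f1 f2 x - convolution M p1 p2 x\<bar>
    \<le> (\<integral>x. \<bar>f1 x - p1 x\<bar> \<partial>M) + (\<integral>x. \<bar>f2 x - p2 x\<bar> \<partial>M)"
proof -
  note u1 = unit_functionD[OF p1] and u2 = unit_functionD[OF p2]
  have m: "f2 \<in> borel_measurable borel" using f2 by (simp add: measurable_M)
  have i1: "integrable M (\<lambda>h. f1 h * f2 (- h + x))"
    by (rule integrable_convolution_integrand[OF f1(1) m f2(2)])
  have i2: "integrable M (\<lambda>h. p1 h * p2 (- h + x))"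
    by (rule integrable_convolution_integrand[OF u1(5) u2(6)]) (use u2 in auto)
  have d1: "integrable M (\<lambda>h. \<bar>f1 h - p1 h\<bar>)" using f1 u1 by simp
  have d2: "integrable M (\<lambda>h. \<bar>f2 (- h + x) - p2 (- h + x)\<bar>)"
    using integrable_reflect[OF f2(1)] integrable_reflect[OF u2(5)] by simp
  have "\<bar>convolution M f1 f2 x - convolution M p1 p2 x\<bar>
      = \<bar>\<integral>h. f1 h * f2 (- h + x) - p1 h * p2 (- h + x) \<partial>M\<bar>"
    unfolding convolution_def using i1 i2 by simp
  also have "\<dots> \<le> (\<integral>h. \<bar>f1 h * f2 (- h + x) - p1 h * p2 (- h + x)\<bar> \<partial>M)"
    by (rule integral_abs_bound)
  also have "\<dots> \<le> (\<integral>h. \<bar>f1 h - p1 h\<bar> + \<bar>f2 (- h + x) - p2 (- h + x)\<bar> \<partial>M)"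
  proof (intro integral_mono Bochner_Integration.integrable_add d1 d2)
    show "integrable M (\<lambda>h. \<bar>f1 h * f2 (- h + x) - p1 h * p2 (- h + x)\<bar>)" using i1 i2 by simp
    fix h
    let ?y = "- h + x"
    have "f1 h * f2 ?y - p1 h * p2 ?y = (f1 h - p1 h) * f2 ?y + p1 h * (f2 ?y - p2 ?y)"
      by (simp add: algebra_simps)
    also have "\<bar>\<dots>\<bar> \<le> \<bar>f1 h - p1 h\<bar> * \<bar>f2 ?y\<bar> + \<bar>p1 h\<bar> * \<bar>f2 ?y - p2 ?y\<bar>"
      by (rule order_trans[OF abs_triangle_ineq]) (simp add: abs_mult)
    also have "\<dots> \<le> \<bar>f1 h - p1 h\<bar> + \<bar>f2 ?y - p2 ?y\<bar>"
      using f2(2)[of ?y] u1(2,3)[of h] by (intro add_mono mult_left_le mult_left_le_one_le) auto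
    finally show "\<bar>f1 h * f2 ?y - p1 h * p2 ?y\<bar> \<le> \<bar>f1 h - p1 h\<bar> + \<bar>f2 ?y - p2 ?y\<bar>" .
  qed
  also have "\<dots> = (\<integral>h. \<bar>f1 h - p1 h\<bar> \<partial>M) + (\<integral>h. \<bar>f2 (- h + x) - p2 (- h + x)\<bar> \<partial>M)"
    by (intro Bochner_Integration.integral_add d1 d2)
  also have "(\<integral>h. \<bar>f2 (- h + x) - p2 (- h + x)\<bar> \<partial>M) = (\<integral>x. \<bar>f2 x - p2 x\<bar> \<partial>M)"
    using integral_reflect[of "\<lambda>x. \<bar>f2 x - p2 x\<bar>" x] m u2(6) by simp
  finally show ?thesis .
qed

lemma convolution_approx:
  assumes f1: "integrable M f1" "\<And>x. f1 x \<in> {0..1}" and f2: "integrable M f2" "\<And>x. f2 x \<in> {0..1}"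
    and e: "0 < e"
  obtains p1 p2 where "unit_function p1" "unit_function p2"
    "\<And>x. \<bar>convolution M f1 f2 x - convolution M p1 p2 x\<bar> \<le> e"
    "(\<integral>x. p1 x \<partial>M) \<le> (\<integral>x. f1 x \<partial>M)" "(\<integral>x. p2 x \<partial>M) \<le> (\<integral>x. f2 x \<partial>M)"
    "(\<integral>x. f1 x \<partial>M) - e \<le> (\<integral>x. p1 x \<partial>M)" "(\<integral>x. f2 x \<partial>M) - e \<le> (\<integral>x. p2 x \<partial>M)"
proof -
  have low: "(\<integral>x. f x \<partial>M) - e \<le> (\<integral>x. p x \<partial>M)"
    if "integrable M f" "unit_function p" "(\<integral>x. \<bar>f x - p x\<bar> \<partial>M) \<le> e / 2" for f p
  proof -
    have "(\<integral>x. f x \<partial>M) - (\<integral>x. p x \<partial>M) = (\<integral>x. f x - p x \<partial>M)"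
      using that unit_functionD(5) by simp
    also have "\<dots> \<le> (\<integral>x. \<bar>f x - p x\<bar> \<partial>M)"
      by (intro integral_mono) (use that unit_functionD(5) in auto)
    finally show ?thesis using that e by simp
  qed
  obtain p1 where p1: "unit_function p1" "(\<integral>x. \<bar>f1 x - p1 x\<bar> \<partial>M) \<le> e / 2" "(\<integral>x. p1 x \<partial>M) \<le> (\<integral>x. f1 x \<partial>M)"
    using unit_function_approx[OF f1, of "e / 2"] e half_gt_zero by blast
  obtain p2 where p2: "unit_function p2" "(\<integral>x. \<bar>f2 x - p2 x\<bar> \<partial>M) \<le> e / 2" "(\<integral>x. p2 x \<partial>M) \<le> (\<integral>x. f2 x \<partial>M)"
    using unit_function_approx[OF f2, of "e / 2"] e half_gt_zero by blast
  have "\<bar>convolution M f1 f2 x - convolution M p1 p2 x\<bar> \<le> e" for x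
    using convolution_close[OF f1 f2 p1(1) p2(1), of x] p1 p2 by simp
  then show ?thesis
    by (rule that[OF p1(1) p2(1) _ p1(3) p2(3) low[OF f1(1) p1(1,2)] low[OF f2(1) p2(1,2)]])
qed

text \<open>A uniform limit of continuous functions, by approximating both factors.\<close>

lemma continuous_convolution:
  assumes f1: "integrable M f1" "\<And>x. f1 x \<in> {0..1}" and f2: "integrable M f2" "\<And>x. f2 x \<in> {0..1}"
  shows "continuous_on UNIV (convolution M f1 f2)"
  unfolding continuous_on_def
proof (intro ballI tendstoI)
  fix x0 and e :: real assume e: "e > 0"
  obtain p1 p2 where p: "unit_function p1" "unit_function p2"
    "\<And>x. \<bar>convolution M f1 f2 x - convolution M p1 p2 x\<bar> \<le> e / 3"
    using convolution_approx[OF f1 f2, of "e / 3"] e by (metis zero_less_divide_iff zero_less_numeral)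
  have "continuous_on UNIV (convolution M p1 p2)"
    by (intro compactly_supported_continuous compactly_supported_convolution unit_functionD(1) p)
  then have "(convolution M p1 p2 \<longlongrightarrow> convolution M p1 p2 x0) (at x0 within UNIV)"
    by (simp add: continuous_on_def)
  then have "\<forall>\<^sub>F x in at x0 within UNIV. dist (convolution M p1 p2 x) (convolution M p1 p2 x0) < e / 3"
    by (rule tendstoD) (use e in simp)
  then show "\<forall>\<^sub>F x in at x0 within UNIV. dist (convolution M f1 f2 x) (convolution M f1 f2 x0) < e"
  proof eventually_elim
    case (elim x)
    then show ?case using p(3)[of x] p(3)[of x0] unfolding dist_real_def by linarith
  qed
qed

lemma convolution_nonneg:
  assumes "\<And>x. f1 x \<in> {0..1}" "\<And>x. f2 x \<in> {0..1}"
  shows "0 \<le> convolution M f1 f2 x"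
  unfolding convolution_def
  by (intro integral_nonneg_AE AE_I2 mult_nonneg_nonneg) (use assms in \<open>auto simp del: add_uminus_conv_diff\<close>)

text \<open>A compactly supported convolution lies within \<open>t\<close> of the given one, which
  is thus at most \<open>t\<close> outside a compact set. This needs \<open>t > 0\<close>.\<close>

lemma compactly_supported_cutoff_convolution:
  assumes f1: "integrable M f1" "\<And>x. f1 x \<in> {0..1}" and f2: "integrable M f2" "\<And>x. f2 x \<in> {0..1}"
    and t: "0 < t"
  shows "compactly_supported (\<lambda>x. cutoff t (convolution M f1 f2 x))"
proof -
  obtain p1 p2 where p: "unit_function p1" "unit_function p2"
    "\<And>x. \<bar>convolution M f1 f2 x - convolution M p1 p2 x\<bar> \<le> t"
    using convolution_approx[OF f1 f2 t] by blast
  obtain K where K: "compact K" "\<And>x. x \<notin> K \<Longrightarrow> convolution M p1 p2 x = 0"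
    using compactly_supported_convolution[OF unit_functionD(1)[OF p(1)] unit_functionD(1)[OF p(2)]]
    by (rule compactly_supportedE) blast
  show ?thesis
  proof (rule compactly_supportedI[OF _ K(1)])
    show "continuous_on UNIV (\<lambda>x. cutoff t (convolution M f1 f2 x))"
      unfolding cutoff_eq_max by (intro continuous_intros continuous_convolution f1 f2)
    show "cutoff t (convolution M f1 f2 x) = 0" if "x \<notin> K" for x
      using p(3)[of x] K(2)[OF that] by (simp add: cutoff_eq_max)
  qed
qed

section \<open>Integral bounds for convolutions and their cutoffs\<close>

text \<open>Both bounds hold for unit functions that approximate the factors with masses converging
  from below, and pass to the limit.\<close>

lemma integral_mult_convolution_le:
  assumes f1: "integrable M f1" "\<And>x. f1 x \<in> {0..1}" and f2: "integrable M f2" "\<And>x. f2 x \<in> {0..1}"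
    and q: "unit_function q"
  shows "(\<integral>x. q x * convolution M f1 f2 x \<partial>M) \<le> (\<integral>x. f1 x \<partial>M) * (\<integral>x. f2 x \<partial>M)"
    and "0 < \<mu> \<Longrightarrow> (\<And>H. open H \<Longrightarrow> is_subgroup H \<Longrightarrow> ennreal \<mu> \<le> emeasure M H) \<Longrightarrow>
      (\<integral>x. f1 x \<partial>M) \<le> \<mu> \<Longrightarrow> (\<integral>x. f2 x \<partial>M) \<le> \<mu> \<Longrightarrow> (\<integral>x. q x \<partial>M) \<le> \<mu> \<Longrightarrow>
      (\<integral>x. q x * convolution M f1 f2 x \<partial>M) \<le> (\<mu> - (\<integral>x. f1 x \<partial>M)) * (\<mu> - (\<integral>x. f2 x \<partial>M))
        + ((\<integral>x. f1 x \<partial>M) + (\<integral>x. f2 x \<partial>M) - \<mu>) * (\<integral>x. q x \<partial>M)"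
proof -
  let ?a = "\<integral>x. f1 x \<partial>M" and ?b = "\<integral>x. f2 x \<partial>M" and ?c = "\<integral>x. q x \<partial>M"
  have "\<forall>n. \<exists>p1 p2. unit_function p1 \<and> unit_function p2 \<and>
    (\<forall>x. \<bar>convolution M f1 f2 x - convolution M p1 p2 x\<bar> \<le> inverse (real (Suc n))) \<and>
    (\<integral>x. p1 x \<partial>M) \<le> ?a \<and> (\<integral>x. p2 x \<partial>M) \<le> ?b \<and>
    ?a - inverse (real (Suc n)) \<le> (\<integral>x. p1 x \<partial>M) \<and> ?b - inverse (real (Suc n)) \<le> (\<integral>x. p2 x \<partial>M)"
  proof
    fix n
    have "0 < inverse (real (Suc n))" by simp
    from convolution_approx[OF f1 f2 this]
    show "\<exists>p1 p2. unit_function p1 \<and> unit_function p2 \<and>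
      (\<forall>x. \<bar>convolution M f1 f2 x - convolution M p1 p2 x\<bar> \<le> inverse (real (Suc n))) \<and>
      (\<integral>x. p1 x \<partial>M) \<le> ?a \<and> (\<integral>x. p2 x \<partial>M) \<le> ?b \<and>
      ?a - inverse (real (Suc n)) \<le> (\<integral>x. p1 x \<partial>M) \<and> ?b - inverse (real (Suc n)) \<le> (\<integral>x. p2 x \<partial>M)"
      by metis
  qed
  then obtain P1 P2 where P: "\<And>n. unit_function (P1 n)" "\<And>n. unit_function (P2 n)"
    "\<And>n x. \<bar>convolution M f1 f2 x - convolution M (P1 n) (P2 n) x\<bar> \<le> inverse (real (Suc n))"
    "\<And>n. (\<integral>x. P1 n x \<partial>M) \<le> ?a" "\<And>n. (\<integral>x. P2 n x \<partial>M) \<le> ?b"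
    "\<And>n. ?a - inverse (real (Suc n)) \<le> (\<integral>x. P1 n x \<partial>M)"
    "\<And>n. ?b - inverse (real (Suc n)) \<le> (\<integral>x. P2 n x \<partial>M)"
    by metis
  have l1: "(\<lambda>n. \<integral>x. P1 n x \<partial>M) \<longlonglongrightarrow> ?a"
  proof (rule tendsto_sandwich[OF _ _ _ tendsto_const])
    show "(\<lambda>n. ?a - inverse (real (Suc n))) \<longlonglongrightarrow> ?a"
      using tendsto_diff[OF tendsto_const LIMSEQ_inverse_real_of_nat, of ?a] by simp
  qed (use P in auto)
  have l2: "(\<lambda>n. \<integral>x. P2 n x \<partial>M) \<longlonglongrightarrow> ?b"
  proof (rule tendsto_sandwich[OF _ _ _ tendsto_const])
    show "(\<lambda>n. ?b - inverse (real (Suc n))) \<longlonglongrightarrow> ?b"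
      using tendsto_diff[OF tendsto_const LIMSEQ_inverse_real_of_nat, of ?b] by simp
  qed (use P in auto)
  have iq: "integrable M (\<lambda>x. q x * convolution M f1 f2 x)"
    by (intro integrable_cs compactly_supported_mult_right unit_functionD(1) q continuous_convolution f1 f2)
  have iP: "integrable M (\<lambda>x. q x * convolution M (P1 n) (P2 n) x)" for n
    by (intro integrable_cs compactly_supported_mult_right unit_functionD(1) q
        compactly_supported_continuous compactly_supported_convolution P)
  have upper: "(\<integral>x. q x * convolution M f1 f2 x \<partial>M)
      \<le> pairing (P2 n) (P1 n) q + ?c * inverse (real (Suc n))" for n
  proof -
    have "(\<integral>x. q x * convolution M f1 f2 x \<partial>M)
        \<le> (\<integral>x. q x * convolution M (P1 n) (P2 n) x + q x * inverse (real (Suc n)) \<partial>M)"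
    proof (intro integral_mono iq Bochner_Integration.integrable_add iP integrable_mult_left unit_functionD(5) q)
      fix x
      have "convolution M f1 f2 x \<le> convolution M (P1 n) (P2 n) x + inverse (real (Suc n))"
        using P(3)[of x n] by linarith
      from mult_left_mono[OF this unit_functionD(2)[OF q, of x]]
      show "q x * convolution M f1 f2 x \<le> q x * convolution M (P1 n) (P2 n) x + q x * inverse (real (Suc n))"
        by (simp only: distrib_left)
    qed
    also have "\<dots> = (\<integral>x. q x * convolution M (P1 n) (P2 n) x \<partial>M) + (\<integral>x. q x * inverse (real (Suc n)) \<partial>M)"
      by (intro Bochner_Integration.integral_add iP integrable_mult_left unit_functionD(5) q)
    also have "(\<integral>x. q x * convolution M (P1 n) (P2 n) x \<partial>M) = pairing (P2 n) (P1 n) q"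
      by (intro pairing_eq_convolution[symmetric] unit_functionD(1,4) P q)
    finally show ?thesis by simp
  qed
  have e0: "(\<lambda>n. ?c * inverse (real (Suc n))) \<longlonglongrightarrow> 0"
    using tendsto_mult[OF tendsto_const LIMSEQ_inverse_real_of_nat, of ?c] by simp
  show "(\<integral>x. q x * convolution M f1 f2 x \<partial>M) \<le> ?a * ?b"
  proof (rule LIMSEQ_le_const)
    show "(\<lambda>n. (\<integral>x. P1 n x \<partial>M) * (\<integral>x. P2 n x \<partial>M) + ?c * inverse (real (Suc n))) \<longlonglongrightarrow> ?a * ?b"
      using tendsto_add[OF tendsto_mult[OF l1 l2] e0] by simp
    have "(\<integral>x. q x * convolution M f1 f2 x \<partial>M)
        \<le> (\<integral>x. P1 n x \<partial>M) * (\<integral>x. P2 n x \<partial>M) + ?c * inverse (real (Suc n))" for n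
      using upper[of n] pairing_le_mult1[OF P(2)[of n] P(1)[of n] q] by linarith
    then show "\<exists>N. \<forall>n\<ge>N. (\<integral>x. q x * convolution M f1 f2 x \<partial>M)
        \<le> (\<integral>x. P1 n x \<partial>M) * (\<integral>x. P2 n x \<partial>M) + ?c * inverse (real (Suc n))" by blast
  qed
  assume \<mu>: "0 < \<mu>" "\<And>H. open H \<Longrightarrow> is_subgroup H \<Longrightarrow> ennreal \<mu> \<le> emeasure M H"
    and le: "?a \<le> \<mu>" "?b \<le> \<mu>" "?c \<le> \<mu>"
  show "(\<integral>x. q x * convolution M f1 f2 x \<partial>M) \<le> (\<mu> - ?a) * (\<mu> - ?b) + (?a + ?b - \<mu>) * ?c"
  proof (rule LIMSEQ_le_const)
    let ?B = "\<lambda>n. (\<mu> - (\<integral>x. P1 n x \<partial>M)) * (\<mu> - (\<integral>x. P2 n x \<partial>M))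
      + ((\<integral>x. P1 n x \<partial>M) + (\<integral>x. P2 n x \<partial>M) - \<mu>) * ?c"
    have "(\<lambda>n. ?B n + ?c * inverse (real (Suc n))) \<longlonglongrightarrow> (\<mu> - ?a) * (\<mu> - ?b) + (?a + ?b - \<mu>) * ?c + 0"
      by (intro tendsto_intros l1 l2 e0)
    then show "(\<lambda>n. ?B n + ?c * inverse (real (Suc n))) \<longlonglongrightarrow> (\<mu> - ?a) * (\<mu> - ?b) + (?a + ?b - \<mu>) * ?c"
      by simp
    have "pairing (P2 n) (P1 n) q \<le> ?B n" for n
      by (intro pairing_upper_bound P q \<mu> order_trans[OF P(4) le(1)] order_trans[OF P(5) le(2)] le(3))
    then have "(\<integral>x. q x * convolution M f1 f2 x \<partial>M) \<le> ?B n + ?c * inverse (real (Suc n))" for n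
      using upper[of n] by (meson add_right_mono order_trans)
    then show "\<exists>N. \<forall>n\<ge>N. (\<integral>x. q x * convolution M f1 f2 x \<partial>M) \<le> ?B n + ?c * inverse (real (Suc n))"
      by blast
  qed
qed

text \<open>The case \<open>t = 0\<close>. The convolution need not have compact support, but its
  cutoffs at levels decreasing to 0 do, and they increase to it; monotone convergence
  applies.\<close>

lemma integral_convolution_le:
  assumes f1: "integrable M f1" "\<And>x. f1 x \<in> {0..1}" and f2: "integrable M f2" "\<And>x. f2 x \<in> {0..1}"
  shows "integrable M (convolution M f1 f2)"
    and "(\<integral>x. convolution M f1 f2 x \<partial>M) \<le> (\<integral>x. f1 x \<partial>M) * (\<integral>x. f2 x \<partial>M)"
proof -
  let ?u = "convolution M f1 f2" and ?ab = "(\<integral>x. f1 x \<partial>M) * (\<integral>x. f2 x \<partial>M)"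
  have u0: "0 \<le> ?u x" for x by (rule convolution_nonneg[OF f1(2) f2(2)])
  define s where "s n = inverse (real (Suc n))" for n
  have s: "0 < s n" for n by (simp add: s_def)
  define w where "w n x = cutoff (s n) (?u x)" for n x
  have cs: "compactly_supported (w n)" for n
    unfolding w_def by (rule compactly_supported_cutoff_convolution[OF f1 f2 s])
  have w0: "0 \<le> w n x" for n x by (simp add: w_def cutoff_eq_max)
  have bound: "(\<integral>x. w n x \<partial>M) \<le> ?ab" for n
  proof -
    \<comment> \<open>Chosen so that \<open>q x * ?u x = w n x\<close>: if \<open>w n x\<close> is
      nonzero, the maximum equals \<open>?u x\<close>. The maximum with \<open>s n\<close> keeps the
      denominator positive.\<close>
    define q where "q x = w n x * inverse (max (?u x) (s n))" for x
    have nz: "max (?u x) (s n) \<noteq> 0" for x using s[of n] by linarith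
    have q: "unit_function q"
    proof (rule unit_functionI)
      show "compactly_supported q"
        unfolding q_def
        by (intro compactly_supported_mult_right cs continuous_on_inverse continuous_intros
            continuous_convolution f1 f2) (use nz in auto)
      show "0 \<le> q x" for x using w0[of n x] s[of n] by (simp add: q_def)
      show "q x \<le> 1" for x
        using s[of n] u0[of x] by (auto simp: q_def w_def cutoff_eq_max field_simps max_def)
    qed
    have "q x * ?u x = w n x" for x
      using s[of n] u0[of x] by (auto simp: q_def w_def cutoff_eq_max max_def)
    then show ?thesis using integral_mult_convolution_le(1)[OF f1 f2 q] by simp
  qed
  have s_mono: "s n \<le> s m" if "m \<le> n" for m n
    using that by (simp add: s_def field_simps)
  have w_mono: "w m x \<le> w n x" if "m \<le> n" for m n x
    using s_mono[OF that] by (auto simp: w_def cutoff_eq_max)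
  have inc: "incseq (\<lambda>n. \<integral>x. w n x \<partial>M)"
    by (intro incseq_SucI integral_mono integrable_cs cs w_mono) simp
  obtain L where L: "(\<lambda>n. \<integral>x. w n x \<partial>M) \<longlonglongrightarrow> L"
    using incseq_convergent[OF inc] bound by blast
  have "s \<longlonglongrightarrow> 0" unfolding s_def by (rule LIMSEQ_inverse_real_of_nat)
  then have "(\<lambda>n. max 0 (?u x - s n)) \<longlonglongrightarrow> max 0 (?u x - 0)" for x
    by (intro tendsto_intros)
  moreover have "max 0 (?u x - 0) = ?u x" for x using u0[of x] by simp
  ultimately have lim: "(\<lambda>n. w n x) \<longlonglongrightarrow> ?u x" for x
    by (simp only: w_def cutoff_eq_max)
  have m: "?u \<in> borel_measurable M"
    unfolding measurable_M[symmetric]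
    by (intro borel_measurable_continuous_onI continuous_convolution f1 f2)
  show "integrable M ?u"
    by (rule integrable_monotone_convergence[OF integrable_cs[OF cs] _ _ L m])
      (use w_mono w0 lim in \<open>auto intro!: monoI\<close>)
  have "integral\<^sup>L M ?u = L"
    by (rule integral_monotone_convergence[OF integrable_cs[OF cs] _ _ L m])
      (use w_mono w0 lim in \<open>auto intro!: monoI\<close>)
  then show "(\<integral>x. ?u x \<partial>M) \<le> ?ab"
    using LIMSEQ_le_const2[OF L] bound by blast
qed

text \<open>The functions \<open>min 1 (r * w x)\<close> tend to the indicator function of the set
  where the convolution exceeds \<open>t\<close>; testing against them recovers the integral of the
  cutoff as \<open>r\<close> grows.\<close>

lemma integral_cutoff_convolution_le:
  assumes f1: "integrable M f1" "\<And>x. f1 x \<in> {0..1}" and f2: "integrable M f2" "\<And>x. f2 x \<in> {0..1}"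
    and t: "0 < t" "t \<le> (\<integral>x. f1 x \<partial>M)" "t \<le> (\<integral>x. f2 x \<partial>M)"
    and vol: "\<And>H. open H \<Longrightarrow> is_subgroup H \<Longrightarrow>
      ennreal ((\<integral>x. f1 x \<partial>M) + (\<integral>x. f2 x \<partial>M) - t) \<le> emeasure M H"
  shows "(\<integral>x. cutoff t (convolution M f1 f2 x) \<partial>M) \<le> ((\<integral>x. f1 x \<partial>M) - t) * ((\<integral>x. f2 x \<partial>M) - t)"
proof -
  define a b where "a = (\<integral>x. f1 x \<partial>M)" and "b = (\<integral>x. f2 x \<partial>M)"
  define \<mu> where "\<mu> = a + b - t"
  have \<mu>: "0 < \<mu>" "a \<le> \<mu>" "b \<le> \<mu>" using t by (auto simp: \<mu>_def a_def b_def)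
  let ?u = "convolution M f1 f2"
  define w where "w x = cutoff t (?u x)" for x
  have w: "compactly_supported w"
    unfolding w_def by (rule compactly_supported_cutoff_convolution[OF f1 f2 t(1)])
  have w0: "0 \<le> w x" for x by (simp add: w_def cutoff_eq_max)
  obtain K where K: "compact K" "\<And>x. x \<notin> K \<Longrightarrow> w x = 0"
    using w by (rule compactly_supportedE) blast
  have bound: "(\<integral>x. w x \<partial>M) \<le> (a - t) * (b - t) + measure M K * inverse (real (Suc n))" for n
  proof -
    define r where "r = real (Suc n)"
    have r: "0 < r" by (simp add: r_def)
    define q where "q x = min 1 (r * w x)" for x
    have q: "unit_function q"
    proof (rule unit_functionI)
      show "compactly_supported q"
        unfolding q_def
        by (rule compactly_supported_compose[OF w, of "\<lambda>y. min 1 (r * y)"]) (auto intro!: continuous_intros)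
    qed (use r w0 in \<open>auto simp: q_def\<close>)
    let ?c = "\<integral>x. q x \<partial>M"
    have qw: "q x * w x = q x * ?u x - t * q x" for x
    proof (cases "t \<le> ?u x")
      case True
      then show ?thesis by (simp add: w_def cutoff_def algebra_simps)
    next
      case False
      then have "w x = 0" by (simp add: w_def cutoff_def)
      then show ?thesis by (simp add: q_def)
    qed
    have iq: "integrable M (\<lambda>x. q x * ?u x)"
      by (intro integrable_cs compactly_supported_mult_right unit_functionD(1) q continuous_convolution f1 f2)
    have "\<bar>(\<integral>x. w x \<partial>M) - (\<integral>x. q x * w x \<partial>M)\<bar> \<le> inverse r * measure M K"
    proof (rule integral_diff_le_on_compact[OF radon K(1)])
      show "integrable M (\<lambda>x. q x * w x)"
        by (intro integrable_cs compactly_supported_mult_left w unit_functionD(4) q)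
      \<comment> \<open>Either \<open>q x\<close> is 1 and the difference vanishes, or
        \<open>w x\<close> itself is below \<open>inverse r\<close>.\<close>
      show "\<bar>w x - q x * w x\<bar> \<le> inverse r" for x
      proof (cases "1 \<le> r * w x")
        case True
        then show ?thesis using r by (simp add: q_def)
      next
        case False
        then have "w x \<le> inverse r" using r by (simp add: field_simps)
        moreover have "0 \<le> q x * w x" "q x * w x \<le> w x"
          using unit_functionD(2,3)[OF q, of x] w0[of x] by (auto intro: mult_left_le_one_le)
        ultimately show ?thesis by simp
      qed
    qed (use integrable_cs[OF w] K in auto)
    moreover have "(\<integral>x. q x * w x \<partial>M) = (\<integral>x. q x * ?u x \<partial>M) - t * ?c"
      unfolding qw using iq unit_functionD(5)[OF q] by simp
    moreover have "(\<integral>x. q x * ?u x \<partial>M) - t * ?c \<le> (a - t) * (b - t)"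
    proof (cases "?c \<le> \<mu>")
      case True
      have "(\<integral>x. q x * ?u x \<partial>M) \<le> (\<mu> - a) * (\<mu> - b) + (a + b - \<mu>) * ?c"
        unfolding a_def b_def
        by (rule integral_mult_convolution_le(2)[OF f1 f2 q \<mu>(1)])
          (use vol \<mu> True in \<open>auto simp: a_def b_def \<mu>_def\<close>)
      also have "\<dots> = (a - t) * (b - t) + t * ?c" by (simp add: \<mu>_def algebra_simps)
      finally show ?thesis by simp
    next
      case False
      \<comment> \<open>For test functions of mass above \<open>\<mu>\<close> the product bound
        suffices, because \<open>a * b - t * \<mu>\<close> is already the required right-hand
        side.\<close>
      then have "t * \<mu> \<le> t * ?c" using t by (intro mult_left_mono) auto
      moreover have "(\<integral>x. q x * ?u x \<partial>M) \<le> a * b"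
        unfolding a_def b_def by (rule integral_mult_convolution_le(1)[OF f1 f2 q])
      moreover have "a * b - t * \<mu> = (a - t) * (b - t)" by (simp add: \<mu>_def algebra_simps)
      ultimately show ?thesis by linarith
    qed
    ultimately show ?thesis unfolding r_def by (simp only: mult.commute)
  qed
  have "(\<lambda>n. (a - t) * (b - t) + measure M K * inverse (real (Suc n))) \<longlonglongrightarrow> (a - t) * (b - t) + measure M K * 0"
    by (intro tendsto_intros LIMSEQ_inverse_real_of_nat)
  then have "(\<integral>x. w x \<partial>M) \<le> (a - t) * (b - t) + measure M K * 0"
    by (rule LIMSEQ_le_const) (use bound in blast)
  then show ?thesis by (simp add: w_def a_def b_def)
qed

end

theorem lemma1p2:
  fixes M :: "'a::{topological_group_add, t2_space} measure"
    and \<phi>1 \<phi>2 :: "'a \<Rightarrow> real" and t :: real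
  assumes "locally_compact_space (euclidean :: 'a topology)"
    and "unimodular_group TYPE('a)"
    and "left_haar_measure M"
    and "integrable M \<phi>1" and "\<And>x. \<phi>1 x \<in> {0..1}"
    and "integrable M \<phi>2" and "\<And>x. \<phi>2 x \<in> {0..1}"
    and "0 \<le> t" and "t \<le> min (L1_norm M \<phi>1) (L1_norm M \<phi>2)"
    and "ennreal (L1_norm M \<phi>1 + L1_norm M \<phi>2) \<le> min_open_subgroup_vol M + ennreal t"
  shows "integrable M (cutoff t \<circ> convolution M \<phi>1 \<phi>2) \<and>
         L1_norm M (cutoff t \<circ> convolution M \<phi>1 \<phi>2)
           \<le> (L1_norm M \<phi>1 - t) * (L1_norm M \<phi>2 - t)"
proof -
  interpret unimodular_haar M
    using assms(1-3) by unfold_locales (auto simp: unimodular_group_def)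
  note f1 = assms(4,5) and f2 = assms(6,7)
  let ?u = "convolution M \<phi>1 \<phi>2"
  have norm: "L1_norm M \<phi>1 = (\<integral>x. \<phi>1 x \<partial>M)" "L1_norm M \<phi>2 = (\<integral>x. \<phi>2 x \<partial>M)"
    using f1(2) f2(2) by (auto simp: L1_norm_def intro!: Bochner_Integration.integral_cong)
  have norm': "L1_norm M (cutoff t \<circ> ?u) = (\<integral>x. cutoff t (?u x) \<partial>M)"
    by (simp add: L1_norm_def cutoff_eq_max)
  show ?thesis
  \<comment> \<open>For \<open>t = 0\<close> the cutoff leaves the nonnegative convolution
    unchanged; for \<open>t > 0\<close> it has compact support.\<close>
  proof (cases "t = 0")
    case True
    have "cutoff t \<circ> ?u = ?u"
      using convolution_nonneg[of \<phi>1 \<phi>2] f1(2) f2(2) by (auto simp: True cutoff_def fun_eq_iff)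
    then show ?thesis
      using integral_convolution_le[OF f1 f2] norm' unfolding norm by (simp add: True comp_def)
  next
    case False
    then have t: "0 < t" "t \<le> (\<integral>x. \<phi>1 x \<partial>M)" "t \<le> (\<integral>x. \<phi>2 x \<partial>M)"
      using assms(8,9) by (auto simp: norm)
    \<comment> \<open>Moving \<open>t\<close> across the inequality is legitimate for a subgroup of
      finite volume, where all terms are real; infinite volume is trivial.\<close>
    have "ennreal ((\<integral>x. \<phi>1 x \<partial>M) + (\<integral>x. \<phi>2 x \<partial>M) - t) \<le> emeasure M H"
      if H: "open H" "is_subgroup H" for H
    proof (cases "emeasure M H")
      case (real r)
      have "min_open_subgroup_vol M \<le> emeasure M H"
        unfolding min_open_subgroup_vol_def by (rule INF_lower) (use H in auto)
      then have "ennreal ((\<integral>x. \<phi>1 x \<partial>M) + (\<integral>x. \<phi>2 x \<partial>M)) \<le> emeasure M H + ennreal t"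
        using assms(10) unfolding norm by (meson add_right_mono order_trans)
      also have "\<dots> = ennreal (r + t)" using real t by simp
      finally have "(\<integral>x. \<phi>1 x \<partial>M) + (\<integral>x. \<phi>2 x \<partial>M) \<le> r + t"
        using real t by (subst (asm) ennreal_le_iff) auto
      then show ?thesis using real by (simp add: ennreal_leI)
    qed simp
    from integral_cutoff_convolution_le[OF f1 f2 t this]
      integrable_cs[OF compactly_supported_cutoff_convolution[OF f1 f2 t(1)]]
    show ?thesis unfolding norm norm' by (simp add: comp_def)
  qed
qed

end
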